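(* Let $G$ be a planar graph and $R\subseteq V(G)$ a set of terminals. (1) If $|R|=3$, then every $R$-CIST of $G$ has size at most $5$. (2) If $|R|\ge 4$, then every $R$-CIST of $G$ has size at most $4$.
   Context: Graphs are finite and connected, may have parallel edges but no loops. For a tree $T$, $\mathrm{int}(T)$ is the set of vertices of degree at least 2 in $T$ and $L(T)$ the set of leaves. An $R$-Steiner tree is a subtree $T$ of $G$ with $R\subseteq V(T)$ and $L(T)\subseteq R$; $T(u,v)$ is the unique $(u,v)$-path in $T$. An $R$-CIST of size $k$ is a set $\{T_1,\dots,T_k\}$ of $R$-Steiner trees such that for all distinct $u,v\in R$ and distinct $i,j$, $T_i(u,v)$ and $T_j(u,v)$ are edge-disjoint and internally vertex-disjoint. *)

theory Defs
  imports "HOL-Analysis.Analysis"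
begin

text \<open>
  Undirected multigraphs: every edge is an element of an abstract type, and \<open>ends\<close> maps it to
  its set of end vertices, so that distinct edges may have the same ends.
\<close>

record ('v, 'e) mgraph =
  verts :: "'v set"
  edges :: "'e set"
  ends :: "'e \<Rightarrow> 'v set"

text \<open>The cardinality condition excludes loops.\<close>

definition multigraph :: "('v, 'e) mgraph \<Rightarrow> bool" where
  "multigraph G \<longleftrightarrow> finite (verts G) \<and> finite (edges G) \<and>
     (\<forall>e \<in> edges G. ends G e \<subseteq> verts G \<and> card (ends G e) = 2)"

text \<open>The function \<open>ends\<close> is total; subgraphs share it, also outside their edge sets.\<close>

definition subgraph :: "('v, 'e) mgraph \<Rightarrow> ('v, 'e) mgraph \<Rightarrow> bool" where
  "subgraph H G \<longleftrightarrow> multigraph H \<and> verts H \<subseteq> verts G \<and> edges H \<subseteq> edges G \<and> ends H = ends G"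

definition vdegree :: "('v, 'e) mgraph \<Rightarrow> 'v \<Rightarrow> nat" where
  "vdegree G v = card {e \<in> edges G. v \<in> ends G e}"

definition leaves :: "('v, 'e) mgraph \<Rightarrow> 'v set" where
  "leaves G = {v \<in> verts G. vdegree G v = 1}"

text \<open>
  A path is recorded as the list of its vertices together with the list of its edges, since
  in a multigraph the vertices alone do not determine it.
\<close>

definition is_path :: "('v, 'e) mgraph \<Rightarrow> 'v \<Rightarrow> 'v list \<times> 'e list \<Rightarrow> 'v \<Rightarrow> bool" where
  "is_path G u p v \<longleftrightarrow> (case p of (vs, es) \<Rightarrow>
     length vs = Suc (length es) \<and> distinct vs \<and> set vs \<subseteq> verts G \<and> set es \<subseteq> edges G \<and>
     hd vs = u \<and> last vs = v \<and>
     (\<forall>i < length es. ends G (es ! i) = {vs ! i, vs ! Suc i}))"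

definition path_edges :: "'v list \<times> 'e list \<Rightarrow> 'e set" where
  "path_edges p = set (snd p)"

definition inner_verts :: "'v list \<times> 'e list \<Rightarrow> 'v set" where
  "inner_verts p = set (fst p) - {hd (fst p), last (fst p)}"

definition connected_graph :: "('v, 'e) mgraph \<Rightarrow> bool" where
  "connected_graph G \<longleftrightarrow> verts G \<noteq> {} \<and>
     (\<forall>u \<in> verts G. \<forall>v \<in> verts G. \<exists>p. is_path G u p v)"

text \<open>
  A cycle is a path together with one further edge joining its two ends; two parallel edges
  form a cycle.
\<close>

definition acyclic_graph :: "('v, 'e) mgraph \<Rightarrow> bool" where
  "acyclic_graph G \<longleftrightarrow>
     \<not> (\<exists>u p v e. is_path G u p v \<and> e \<in> edges G - path_edges p \<and> ends G e = {u, v})"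

definition tree :: "('v, 'e) mgraph \<Rightarrow> bool" where
  "tree T \<longleftrightarrow> multigraph T \<and> connected_graph T \<and> acyclic_graph T"

text \<open>
  The path \<open>T(u,v)\<close>. It is meaningful for vertices \<open>u\<close>, \<open>v\<close> of a tree \<open>T\<close>; see
  \<open>tree_path_unique\<close> below.
\<close>

definition tree_path :: "('v, 'e) mgraph \<Rightarrow> 'v \<Rightarrow> 'v \<Rightarrow> 'v list \<times> 'e list" where
  "tree_path T u v = (THE p. is_path T u p v)"

definition steiner_tree :: "('v, 'e) mgraph \<Rightarrow> 'v set \<Rightarrow> ('v, 'e) mgraph \<Rightarrow> bool" where
  "steiner_tree G R T \<longleftrightarrow> subgraph T G \<and> tree T \<and> R \<subseteq> verts T \<and> leaves T \<subseteq> R"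

definition CIST :: "('v, 'e) mgraph \<Rightarrow> 'v set \<Rightarrow> ('v, 'e) mgraph set \<Rightarrow> bool" where
  "CIST G R \<T> \<longleftrightarrow> finite \<T> \<and> (\<forall>T \<in> \<T>. steiner_tree G R T) \<and>
     (\<forall>u \<in> R. \<forall>v \<in> R. u \<noteq> v \<longrightarrow> (\<forall>T \<in> \<T>. \<forall>T' \<in> \<T>. T \<noteq> T' \<longrightarrow>
        path_edges (tree_path T u v) \<inter> path_edges (tree_path T' u v) = {} \<and>
        inner_verts (tree_path T u v) \<inter> inner_verts (tree_path T' u v) = {}))"

text \<open>
  Planarity is the existence of a drawing in the plane, modelled by \<open>complex\<close>: vertices are
  distinct points, edges are arcs (continuous injective images of the unit interval) joining
  their end vertices, an edge contains no vertex other than its ends, and two distinct edges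
  meet only in common ends.
\<close>

definition planar_drawing ::
  "('v, 'e) mgraph \<Rightarrow> ('v \<Rightarrow> complex) \<Rightarrow> ('e \<Rightarrow> real \<Rightarrow> complex) \<Rightarrow> bool" where
  "planar_drawing G \<phi> \<gamma> \<longleftrightarrow>
     inj_on \<phi> (verts G) \<and>
     (\<forall>e \<in> edges G. arc (\<gamma> e) \<and> {pathstart (\<gamma> e), pathfinish (\<gamma> e)} = \<phi> ` ends G e \<and>
        path_image (\<gamma> e) \<inter> \<phi> ` verts G = \<phi> ` ends G e) \<and>
     (\<forall>e \<in> edges G. \<forall>f \<in> edges G. e \<noteq> f \<longrightarrow>
        path_image (\<gamma> e) \<inter> path_image (\<gamma> f) = \<phi> ` (ends G e \<inter> ends G f))"

definition planar :: "('v, 'e) mgraph \<Rightarrow> bool" where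
  "planar G \<longleftrightarrow> (\<exists>\<phi> \<gamma>. planar_drawing G \<phi> \<gamma>)"

lemma is_path_append:
  assumes "is_path G u (xs, es) v" "is_path G v (y # ys, fs) w" "set xs \<inter> set ys = {}"
  shows "is_path G u (xs @ ys, es @ fs) w"
proof -
  have a: "length xs = Suc (length es)" "xs \<noteq> []" "hd xs = u" "last xs = v" "y = v"
    "length ys = length fs" 
    using assms unfolding is_path_def by auto
  have l: "xs ! length es = v" using a by (metis diff_Suc_1 last_conv_nth)
  have "ends G ((es @ fs) ! i) = {(xs @ ys) ! i, (xs @ ys) ! Suc i}"
    if i: "i < length es + length fs" for i
  proof (cases "i < length es")
    case True
    then show ?thesis using assms(1) a by (auto simp: is_path_def nth_append)
  next
    case False
    define j where "j = i - length es"
    have ij: "i = length es + j" "j < length fs" using False i j_def by auto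
    have "ends G (fs ! j) = {(y # ys) ! j, ys ! j}"
      using assms(2) ij by (auto simp: is_path_def)
    moreover have "(xs @ ys) ! i = (y # ys) ! j"
      using a l ij by (cases j) (auto simp: nth_append)
    ultimately show ?thesis using a ij by (auto simp: nth_append)
  qed
  moreover have "last (xs @ ys) = w"
    using assms(2) a by (cases "ys = []") (auto simp: is_path_def)
  ultimately show ?thesis using assms a by (auto simp: is_path_def)
qed

lemma is_path_rev:
  assumes "is_path G u (xs, es) v"
  shows "is_path G v (rev xs, rev es) u"
proof -
  have a: "length xs = Suc (length es)" "xs \<noteq> []" using assms by (auto simp: is_path_def)
  have "ends G (rev es ! i) = {rev xs ! i, rev xs ! Suc i}" if i: "i < length es" for i
  proof -
    have "ends G (es ! (length es - Suc i)) = {xs ! (length es - Suc i), xs ! Suc (length es - Suc i)}"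
      using assms i by (auto simp: is_path_def)
    moreover have "Suc (length es - Suc i) = length es - i" using i by simp
    ultimately show ?thesis using i a by (auto simp: rev_nth insert_commute)
  qed
  then show ?thesis using assms a by (auto simp: is_path_def hd_rev last_rev)
qed

lemma is_path_take:
  assumes "is_path G u (xs, es) v" "j \<le> length es"
  shows "is_path G u (take (Suc j) xs, take j es) (xs ! j)"
proof -
  have "length xs = Suc (length es)" "xs \<noteq> []" using assms by (auto simp: is_path_def)
  moreover from this have "last (take (Suc j) xs) = xs ! j"
    using assms(2) by (simp add: take_Suc_conv_app_nth)
  ultimately show ?thesis
    using assms set_take_subset[of "Suc j" xs] set_take_subset[of j es]
    by (auto simp: is_path_def hd_take)
qed

lemma is_path_tl:
  assumes "is_path G u (x # xs, e # es) v"
  shows "is_path G (hd xs) (xs, es) v"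
  using assms by (auto simp: is_path_def split: if_splits)

lemma acyclic_path_unique:
  assumes "acyclic_graph G"
  shows "is_path G u (vs, es) v \<Longrightarrow> is_path G u (ws, fs) v \<Longrightarrow> (vs, es) = (ws, fs)"
proof (induction es arbitrary: u vs ws fs)
  case Nil
  then have "vs = [u]" "u = v" by (auto simp: is_path_def length_Suc_conv)
  moreover from Nil this have "ws = [u]"
    by (cases ws) (auto simp: is_path_def split: if_splits)
  ultimately show ?case using Nil by (auto simp: is_path_def)
next
  case (Cons e es)
  obtain vs' where vs: "vs = u # vs'" using Cons.prems(1) by (cases vs) (auto simp: is_path_def)
  obtain ws' where ws: "ws = u # ws'" using Cons.prems(2) by (cases ws) (auto simp: is_path_def)
  have vs': "vs' \<noteq> []" "last vs' = v" using Cons.prems(1) vs by (auto simp: is_path_def)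
  have vu: "v \<noteq> u" using Cons.prems(1) vs vs' by (auto simp: is_path_def)
  then have ws'n: "ws' \<noteq> []" using Cons.prems(2) ws by (auto simp: is_path_def)
  then obtain f fs' where fs: "fs = f # fs'"
    using Cons.prems(2) ws by (cases fs) (auto simp: is_path_def)
  have ends_e: "ends G e = {u, hd vs'}"
    using Cons.prems(1) vs vs' by (auto simp: is_path_def hd_conv_nth)
  have ends_f: "ends G f = {u, hd ws'}" "f \<in> edges G"
    using Cons.prems(2) ws ws'n fs by (auto simp: is_path_def hd_conv_nth)
  have tv: "is_path G (hd vs') (vs', es) v" using Cons.prems(1) vs by (auto intro: is_path_tl)
  have tw: "is_path G (hd ws') (ws', fs') v" using Cons.prems(2) ws fs by (auto intro: is_path_tl)
  show ?case
  proof (cases "e = f")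
    case True
    have "hd vs' \<noteq> u" "hd ws' \<noteq> u"
      using Cons.prems vs ws vs' ws'n by (auto simp: is_path_def)
    then have "hd vs' = hd ws'" using ends_e ends_f True by (auto simp: doubleton_eq_iff)
    then show ?thesis using Cons.IH[OF tv] tw True vs ws fs by auto
  next
    case False
    have lv: "length vs' = Suc (length es)" and lw: "length ws' = Suc (length fs')"
      using tv tw by (auto simp: is_path_def)
    have "v \<in> set ws'" using tw ws'n by (auto simp: is_path_def)
    then have ex: "\<exists>j. j \<le> length es \<and> vs' ! j \<in> set ws'"
      using vs' lv by (intro exI[of _ "length es"]) (auto simp: last_conv_nth)
    define j where "j = (LEAST j. j \<le> length es \<and> vs' ! j \<in> set ws')"
    have j: "j \<le> length es" "vs' ! j \<in> set ws'" using LeastI_ex[OF ex] j_def by auto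
    have jmin: "vs' ! i \<notin> set ws'" if "i < j" for i
      using not_less_Least[of i "\<lambda>j. j \<le> length es \<and> vs' ! j \<in> set ws'"] that j j_def by auto
    obtain k where k: "k \<le> length fs'" "ws' ! k = vs' ! j"
      using j lw by (auto simp: in_set_conv_nth less_Suc_eq_le)
    define A where "A = (take (Suc k) ws', take k fs')"
    have A: "is_path G (hd ws') A (vs' ! j)" using is_path_take[OF tw k(1)] k A_def by auto
    have "is_path G u (take (Suc (Suc j)) vs, take (Suc j) (e # es)) (vs ! Suc j)"
      using is_path_take[OF Cons.prems(1), of "Suc j"] j by auto
    then have "is_path G u (u # take (Suc j) vs', take (Suc j) (e # es)) (vs' ! j)"
      using vs by auto
    moreover have "take (Suc j) vs' = take j vs' @ [vs' ! j]"
      using j lv by (simp add: take_Suc_conv_app_nth)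
    ultimately have "is_path G (vs' ! j) (vs' ! j # rev (u # take j vs'), rev (take (Suc j) (e # es))) u"
      using is_path_rev by fastforce
    moreover have "u \<notin> set ws'" using Cons.prems(2) ws by (auto simp: is_path_def)
    then have "set (take (Suc k) ws') \<inter> set (rev (u # take j vs')) = {}"
      using jmin set_take_subset[of "Suc k" ws'] j lv by (auto simp: in_set_conv_nth)
    ultimately have P: "is_path G (hd ws') (take (Suc k) ws' @ rev (u # take j vs'),
        take k fs' @ rev (take (Suc j) (e # es))) u"
      using is_path_append A A_def by metis
    have "f \<notin> set fs'"
    proof
      assume "f \<in> set fs'"
      then obtain i where "i < length fs'" "fs' ! i = f" by (auto simp: in_set_conv_nth)
      then have "ends G f = {ws' ! i, ws' ! Suc i}" "{ws' ! i, ws' ! Suc i} \<subseteq> set ws'"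
        using tw lw by (auto simp: is_path_def)
      then show False using ends_f \<open>u \<notin> set ws'\<close> by (metis insertI1 subsetD)
    qed
    moreover have "f \<notin> set es"
    proof
      assume "f \<in> set es"
      then obtain i where "i < length es" "es ! i = f" by (auto simp: in_set_conv_nth)
      then have "ends G f = {vs' ! i, vs' ! Suc i}" "{vs' ! i, vs' ! Suc i} \<subseteq> set vs'"
        using tv lv by (auto simp: is_path_def)
      moreover have "u \<notin> set vs'" using Cons.prems(1) vs by (auto simp: is_path_def)
      ultimately show False using ends_f by (metis insertI1 subsetD)
    qed
    ultimately have "f \<notin> path_edges (take (Suc k) ws' @ rev (u # take j vs'),
        take k fs' @ rev (take (Suc j) (e # es)))"
      using False by (auto simp: path_edges_def dest: in_set_takeD)
    then show ?thesis using P ends_f assms unfolding acyclic_graph_def by blast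
  qed
qed

lemma tree_path_unique:
  assumes "tree T" "u \<in> verts T" "v \<in> verts T"
  shows "\<exists>!p. is_path T u p v"
  using assms acyclic_path_unique[of T u _ _ v]
  unfolding tree_def connected_graph_def by (metis surj_pair)

end

theory Submission
  imports Defs
begin

text \<open>
  Removing a vertex or an edge from a tree splits the terminals into classes, and the union of two
  proper equivalence relations is never total; so in a CIST every vertex is an inner vertex of
  paths between terminals in at most one tree, and different trees share no edge of such paths.
  Three terminals that are inner vertices of none of three trees would yield a drawing of a
  subdivided \<open>K_{3,3}\<close>. If five trees exist for at least four terminals and this does not happen, four
  terminals are inner vertices of four different trees and, with a fifth tree, form a \<open>K_5\<close> minor:
  the Jordan curve through the four terminals is crossed by two interlaced chords and by the fifth
  tree, no two of which can lie on the same side of it.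
\<close>

text \<open>The constants come from counting. A terminal is an inner vertex of at most one tree, so
  three terminals rule out at most three trees; six trees would leave three in which these terminals
  occur only as ends of paths. With five trees and four terminals the same count must be tight for
  every triple, so each terminal owns a tree of its own and the fifth tree is owned by none. The
  obstacle is in the second case: the six connections between four terminals are drawn with four
  trees, two of them serve twice, and their two paths may overlap near the common terminal. So no
  subdivision with internally disjoint edges is at hand. Overlapping paths are cut at the first
  common vertex, branch sets are kept as connected plane sets, and the contradiction comes from the
  Jordan curve directly, without contracting anything.\<close>

section \<open>Cutting and joining paths\<close>

definition path_verts :: "'v list \<times> 'e list \<Rightarrow> 'v set" where
  "path_verts p = set (fst p)"

lemma inner_verts_is_path:
  "is_path G u p v \<Longrightarrow> inner_verts p = path_verts p - {u, v}"
  by (auto simp: is_path_def inner_verts_def path_verts_def split: prod.splits)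

lemma path_ends_mem:
  assumes "is_path G u p v"
  shows "u \<in> path_verts p" "v \<in> path_verts p"
  using assms by (cases "fst p"; auto simp: is_path_def path_verts_def split: prod.splits if_splits)+

lemma path_in_graph:
  assumes "is_path G u p v"
  shows "path_verts p \<subseteq> verts G" "path_edges p \<subseteq> edges G"
  using assms by (auto simp: is_path_def path_verts_def path_edges_def split: prod.splits)

lemma path_edge_ends:
  assumes "is_path G u p v" "e \<in> path_edges p"
  shows "ends G e \<subseteq> path_verts p"
proof -
  obtain vs es where p: "p = (vs, es)" by force
  obtain i where "i < length es" "es ! i = e"
    using assms p by (auto simp: path_edges_def in_set_conv_nth)
  then have "ends G e = {vs ! i, vs ! Suc i}" "i < length vs" "Suc i < length vs"
    using assms p by (auto simp: is_path_def)
  then show ?thesis using p by (auto simp: path_verts_def)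
qed

lemma trivial_path_edges:
  assumes "is_path G u p u"
  shows "path_edges p = {}"
proof -
  obtain vs es where p: "p = (vs, es)" by force
  have "distinct vs" "vs \<noteq> []" "hd vs = last vs" "length vs = Suc (length es)"
    using assms p by (auto simp: is_path_def)
  then have "es = []" by (cases vs) (auto split: if_splits)
  then show ?thesis using p by (simp add: path_edges_def)
qed

lemma is_path_reverse:
  assumes "is_path G u p v"
  obtains q where "is_path G v q u" "path_verts q = path_verts p" "path_edges q = path_edges p"
proof -
  obtain vs es where p: "p = (vs, es)" by force
  show ?thesis
    using that[of "(rev vs, rev es)"] is_path_rev[of G u vs es v] assms p
    by (auto simp: path_verts_def path_edges_def)
qed

lemma is_path_join:
  assumes "is_path G u p m" "is_path G m q v" "path_verts p \<inter> path_verts q = {m}"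
  obtains r where "is_path G u r v" "path_verts r = path_verts p \<union> path_verts q"
    "path_edges r = path_edges p \<union> path_edges q"
proof -
  obtain xs es where p: "p = (xs, es)" by force
  obtain ws fs where q: "q = (ws, fs)" by force
  obtain y ys where ws: "ws = y # ys" using assms(2) q by (cases ws) (auto simp: is_path_def)
  have y: "y = m" "y \<notin> set ys" using assms(2) q ws by (auto simp: is_path_def)
  have "set xs \<inter> set ys = {}" using assms(3) y p q ws by (auto simp: path_verts_def)
  then have "is_path G u (xs @ ys, es @ fs) v"
    using is_path_append assms p q ws by metis
  moreover have "y \<in> set xs" using assms(3) y p by (auto simp: path_verts_def)
  ultimately show ?thesis
    using that[of "(xs @ ys, es @ fs)"] p q ws by (auto simp: path_verts_def path_edges_def)
qed

lemma is_path_split: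
  assumes "is_path G u p v" "m \<in> path_verts p"
  obtains q r where "is_path G u q m" "is_path G m r v" "path_verts q \<inter> path_verts r = {m}"
    "path_verts p = path_verts q \<union> path_verts r" "path_edges p = path_edges q \<union> path_edges r"
proof -
  obtain vs es where p: "p = (vs, es)" by force
  have len: "length vs = Suc (length es)" and d: "distinct vs"
    using assms p by (auto simp: is_path_def)
  obtain j where j: "j \<le> length es" "vs ! j = m"
    using assms p len by (auto simp: path_verts_def in_set_conv_nth less_Suc_eq_le)
  have q: "is_path G u (take (Suc j) vs, take j es) m"
    using is_path_take[of G u vs es v j] assms p j by auto
  have "is_path G m (drop j vs, drop j es) v"
    using assms p j len by (auto simp: is_path_def hd_drop_conv_nth dest: in_set_dropD)
  moreover have "set (take (Suc j) vs) \<inter> set (drop j vs) = {m}"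
  proof -
    have "take (Suc j) vs = take j vs @ [m]" using j len by (simp add: take_Suc_conv_app_nth)
    moreover have "m \<in> set (drop j vs)"
      using j len by (metis Cons_nth_drop_Suc le_imp_less_Suc list.set_intros(1))
    moreover have "set (take j vs) \<inter> set (drop j vs) = {}"
      using d by (simp add: set_take_disj_set_drop_if_distinct)
    ultimately show ?thesis by auto
  qed
  moreover have "set vs = set (take (Suc j) vs) \<union> set (drop j vs)"
  proof -
    have "set vs = set (take j vs) \<union> set (drop j vs)" by (metis append_take_drop_id set_append)
    moreover have "set (take j vs) \<subseteq> set (take (Suc j) vs)" by (simp add: set_take_subset_set_take)
    ultimately show ?thesis by (auto dest: in_set_takeD)
  qed
  moreover have "set es = set (take j es) \<union> set (drop j es)"
    by (metis append_take_drop_id set_append)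
  ultimately show ?thesis
    using that[of "(take (Suc j) vs, take j es)" "(drop j vs, drop j es)"] q p
    by (auto simp: path_verts_def path_edges_def)
qed

lemma path_first_hit:
  assumes "is_path G u p v" "v \<in> S"
  obtains q m where "is_path G u q m" "path_verts q \<inter> S = {m}"
    "path_verts q \<subseteq> path_verts p" "path_edges q \<subseteq> path_edges p"
proof -
  obtain vs es where p: "p = (vs, es)" by force
  have len: "length vs = Suc (length es)" and "vs \<noteq> []" "last vs = v"
    using assms p by (auto simp: is_path_def)
  then have ex: "\<exists>j. j \<le> length es \<and> vs ! j \<in> S"
    using assms(2) by (intro exI[of _ "length es"]) (auto simp: last_conv_nth)
  define j where "j = (LEAST j. j \<le> length es \<and> vs ! j \<in> S)"
  have j: "j \<le> length es" "vs ! j \<in> S" using LeastI_ex[OF ex] j_def by auto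
  have jmin: "vs ! i \<notin> S" if "i < j" for i
    using not_less_Least[of i "\<lambda>j. j \<le> length es \<and> vs ! j \<in> S"] that j j_def by auto
  have "set (take (Suc j) vs) \<inter> S = {vs ! j}"
    using j jmin len by (force simp: take_Suc_conv_app_nth in_set_conv_nth)
  then show ?thesis
    using that[of "(take (Suc j) vs, take j es)" "vs ! j"] is_path_take[of G u vs es v j] assms(1) p j
    by (auto simp: path_verts_def path_edges_def dest: in_set_takeD)
qed

text \<open>A common edge would have both its ends among the common vertices, and without loops
  these are two different vertices.\<close>

lemma path_edges_disjoint:
  assumes "multigraph G" "is_path G u p v" "is_path G u' q v'" "path_verts p \<inter> path_verts q \<subseteq> {m}"
  shows "path_edges p \<inter> path_edges q = {}"
proof (rule ccontr)
  assume "path_edges p \<inter> path_edges q \<noteq> {}"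
  then obtain e where e: "e \<in> path_edges p" "e \<in> path_edges q" by auto
  then have "ends G e \<subseteq> {m}"
    using path_edge_ends assms by (metis Int_greatest subset_trans)
  moreover have "card (ends G e) = 2"
    using assms path_in_graph e by (meson multigraph_def subsetD)
  ultimately show False
    by (metis card.empty card_1_singleton_iff numeral_eq_one_iff One_nat_def subset_singletonD zero_neq_numeral semiring_norm(85))
qed

section \<open>Crosscuts and the two sides of a Jordan curve\<close>

text \<open>Two interlaced crosscuts \<open>P\<close>, \<open>Q\<close> of a Jordan curve cannot lie on the same side: \<open>Q\<close> and
  the opposite side are joined near \<open>y\<close> in the complement of \<open>A1 \<union> P\<close> and near \<open>x\<close> in the
  complement of \<open>A2 \<union> P\<close>, hence, by Janiszewski, in the complement of the curve.\<close>

lemma interlaced_crosscuts: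
  fixes c :: "real \<Rightarrow> complex"
  assumes c: "simple_path c" "pathfinish c = pathstart c"
    and A: "closed A1" "closed A2" "A1 \<union> A2 = path_image c" "A1 \<inter> A2 \<subseteq> P"
    and P: "compact P" "connected P"
    and Q: "connected Q" "Q \<inter> P = {}"
    and x: "x \<in> A1 - A2 - P" "x \<in> closure Q"
    and y: "y \<in> A2 - A1 - P" "y \<in> closure Q"
    and M: "connected M" "M \<inter> path_image c = {}" "Q \<subseteq> M" "P - path_image c \<subseteq> M"
  shows False
proof -
  let ?J = "path_image c"
  obtain I1 I2 where sides: "I1 \<noteq> {}" "open I1" "connected I1" "I2 \<noteq> {}" "open I2" "connected I2"
    "I1 \<inter> I2 = {}" "I1 \<union> I2 = - ?J" "frontier I1 = ?J" "frontier I2 = ?J"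
    using Jordan_curve[OF c] by metis
  obtain q where q: "q \<in> Q" using x(2) by (metis closure_empty empty_iff ex_in_conv)
  \<comment> \<open>\<open>V\<close> is the side that contains \<open>M\<close>, \<open>U\<close>
    the opposite one. As \<open>P\<close> off the curve lies in \<open>M\<close>, \<open>U\<close>
    is disjoint from \<open>P\<close> as well as from \<open>Q\<close>.\<close>
  have "\<exists>U V. M \<subseteq> V \<and> U \<inter> V = {} \<and> U \<union> V = - ?J \<and> open U \<and> open V \<and> connected U \<and> U \<noteq> {} \<and> frontier U = ?J"
  proof (cases "M \<inter> I1 = {}")
    case True
    then have "M \<subseteq> I2" using M(2) sides by auto
    then show ?thesis using sides by blast
  next
    case False
    have "M \<inter> I2 = {}"
      using connectedD[OF M(1) sides(2) sides(5)] False M(2) sides(7,8) by blast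
    then have "M \<subseteq> I1" using M(2) sides by auto
    then show ?thesis using sides by (metis Int_commute Un_commute)
  qed
  then obtain U V where UV: "M \<subseteq> V" "U \<inter> V = {}" "U \<union> V = - ?J" "open U" "open V" "connected U"
    "U \<noteq> {}" "frontier U = ?J" by blast
  obtain u where u: "u \<in> U" using UV by auto
  have dis: "U \<inter> P = {}" "U \<inter> ?J = {}" "Q \<inter> ?J = {}" using UV M by blast+
  have JU: "?J \<subseteq> closure U" using UV by (auto simp: frontier_def)
  have comp: "connected_component (- K) q u"
    if K: "closed K" "K \<subseteq> ?J \<union> P" "z \<notin> K" "z \<in> closure Q" "z \<in> ?J" for K z
  proof -
    obtain e where e: "e > 0" "ball z e \<subseteq> - K" using K by (metis ComplI open_Compl openE)
    have "ball z e \<inter> Q \<noteq> {}" "ball z e \<inter> U \<noteq> {}"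
      using e K JU by (metis centre_in_ball disjoint_iff open_ball open_Int_closure_eq_empty subsetD)+
    then have "connected (ball z e \<union> Q \<union> U)"
      using Q UV by (intro connected_Un) auto
    moreover have "ball z e \<union> Q \<union> U \<subseteq> - K" using e K dis Q by blast
    ultimately show ?thesis using q u by (auto simp: connected_component_def)
  qed
  have "compact ?J" using c(1) by (simp add: compact_simple_path_image)
  moreover have "A1 = ?J \<inter> A1" "A2 = ?J \<inter> A2" using A(3) by auto
  ultimately have cl: "compact A1" "compact A2" using A(1,2) by (metis compact_Int_closed)+
  \<comment> \<open>Janiszewski's theorem asks for two sets with connected intersection. The parts
    \<open>A1\<close>, \<open>A2\<close> alone may meet in two points; adding \<open>P\<close> to
    both makes the intersection equal to the connected set \<open>P\<close>.\<close>
  have "(A1 \<union> P) \<inter> (A2 \<union> P) = P" using A(4) by auto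
  moreover have "connected_component (- (A1 \<union> P)) q u"
    by (rule comp[of _ y]) (use x y A cl P in \<open>auto intro: compact_imp_closed\<close>)
  moreover have "connected_component (- (A2 \<union> P)) q u"
    by (rule comp[of _ x]) (use x y A cl P in \<open>auto intro: compact_imp_closed\<close>)
  ultimately have "connected_component (- ((A1 \<union> P) \<union> (A2 \<union> P))) q u"
    using cl P by (metis Janiszewski compact_Un compact_imp_closed)
  then obtain C where C: "connected C" "C \<subseteq> - ?J" "q \<in> C" "u \<in> C"
    using A(3) unfolding connected_component_def by blast
  then show False
    using connectedD[OF C(1) UV(4,5)] C UV(1-3) q u M(3) by blast
qed

text \<open>Pigeonhole: a connected set off the curve stays on one of only two sides.
  \<open>M\<close> is a whole side, the connected set off the curve that
  \<open>interlaced_crosscuts\<close> asks for.\<close>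

lemma two_of_three_on_one_side:
  fixes c :: "real \<Rightarrow> complex"
  assumes c: "simple_path c" "pathfinish c = pathstart c"
    and "connected K" "connected L" "connected N"
    and "K \<inter> path_image c = {}" "L \<inter> path_image c = {}" "N \<inter> path_image c = {}"
  obtains M where "connected M" "M \<inter> path_image c = {}"
    "K \<subseteq> M \<and> L \<subseteq> M \<or> K \<subseteq> M \<and> N \<subseteq> M \<or> L \<subseteq> M \<and> N \<subseteq> M"
proof -
  obtain I1 I2 where sides: "open I1" "connected I1" "open I2" "connected I2"
    "I1 \<inter> I2 = {}" "I1 \<union> I2 = - path_image c"
    using Jordan_curve[OF c] by metis
  have side: "C \<subseteq> I1 \<or> C \<subseteq> I2" if "connected C" "C \<inter> path_image c = {}" for C
    using connectedD[OF that(1) sides(1,3)] that(2) sides(5,6) by blast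
  have "K \<subseteq> I1 \<or> K \<subseteq> I2" "L \<subseteq> I1 \<or> L \<subseteq> I2" "N \<subseteq> I1 \<or> N \<subseteq> I2"
    using side assms by simp_all
  then consider "K \<subseteq> I1 \<and> L \<subseteq> I1 \<or> K \<subseteq> I1 \<and> N \<subseteq> I1 \<or> L \<subseteq> I1 \<and> N \<subseteq> I1"
    | "K \<subseteq> I2 \<and> L \<subseteq> I2 \<or> K \<subseteq> I2 \<and> N \<subseteq> I2 \<or> L \<subseteq> I2 \<and> N \<subseteq> I2"
    by metis
  then show ?thesis
  proof cases
    case 1
    then show ?thesis using that[of I1] sides by blast
  next
    case 2
    then show ?thesis using that[of I2] sides by blast
  qed
qed

lemma arc_minus_ends:
  assumes "arc g"
  shows "connected (path_image g - {pathstart g})"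
    and "connected (path_image g - {pathstart g, pathfinish g})"
    and "pathstart g \<in> closure (path_image g - {pathstart g, pathfinish g})"
    and "pathfinish g \<in> closure (path_image g - {pathstart g, pathfinish g})"
proof -
  have cont: "continuous_on {0..1} g" and inj: "inj_on g {0..1}"
    using assms by (auto simp: arc_def path_def)
  have "{0..1} - {0} = {0<..1::real}" "{0..1} - {0, 1} = {0<..<1::real}" by auto
  then have 1: "path_image g - {pathstart g} = g ` {0<..1}"
    and 2: "path_image g - {pathstart g, pathfinish g} = g ` {0<..<1}"
    using inj_on_image_set_diff[OF inj, of "{0..1}" "{0}"]
      inj_on_image_set_diff[OF inj, of "{0..1}" "{0, 1}"]
    by (auto simp: path_image_def pathstart_def pathfinish_def greaterThanAtMost_subseteq_atLeastAtMost_iff greaterThanLessThan_subseteq_atLeastAtMost_iff)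
  show "connected (path_image g - {pathstart g})"
    unfolding 1 by (intro connected_continuous_image continuous_on_subset[OF cont]) auto
  show "connected (path_image g - {pathstart g, pathfinish g})"
    unfolding 2 by (intro connected_continuous_image continuous_on_subset[OF cont]) auto
  have "g ` closure {0<..<1} \<subseteq> closure (g ` {0<..<1})"
    using cont by (intro image_closure_subset) (auto simp: closure_subset)
  then show "pathstart g \<in> closure (path_image g - {pathstart g, pathfinish g})"
    "pathfinish g \<in> closure (path_image g - {pathstart g, pathfinish g})"
    unfolding 2 by (auto simp: pathstart_def pathfinish_def)
qed

section \<open>Paths in a tree\<close>

lemma tree_path_is_path:
  assumes "tree T" "u \<in> verts T" "v \<in> verts T"
  shows "is_path T u (tree_path T u v) v"
  unfolding tree_path_def using theI'[OF tree_path_unique[OF assms]] .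

lemma tree_path_eqI:
  assumes "tree T" "is_path T u p v"
  shows "tree_path T u v = p"
proof -
  have "u \<in> verts T" "v \<in> verts T" using path_ends_mem[OF assms(2)] path_in_graph(1)[OF assms(2)] by auto
  then show ?thesis
    using tree_path_unique tree_path_is_path assms by metis
qed

lemma tree_path_sym:
  assumes "tree T" "u \<in> verts T" "v \<in> verts T"
  shows "path_verts (tree_path T v u) = path_verts (tree_path T u v)"
    and "path_edges (tree_path T v u) = path_edges (tree_path T u v)"
  using is_path_reverse[OF tree_path_is_path[OF assms]] tree_path_eqI[OF assms(1)] by metis+

text \<open>Follow the path from \<open>a\<close> until it first meets the path from
  \<open>b\<close> to \<open>c\<close>, then turn towards \<open>c\<close>: the result is a path,
  hence the tree path. This is what makes "not separated by a given vertex or edge"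
  transitive.\<close>

lemma tree_path_via:
  assumes T: "tree T" and "a \<in> verts T" "b \<in> verts T" "c \<in> verts T"
  shows "path_verts (tree_path T a c) \<subseteq> path_verts (tree_path T a b) \<union> path_verts (tree_path T b c)"
    and "path_edges (tree_path T a c) \<subseteq> path_edges (tree_path T a b) \<union> path_edges (tree_path T b c)"
proof -
  note ab = tree_path_is_path[OF T assms(2,3)] and bc = tree_path_is_path[OF T assms(3,4)]
  obtain q m where q: "is_path T a q m" "path_verts q \<inter> path_verts (tree_path T b c) = {m}"
    "path_verts q \<subseteq> path_verts (tree_path T a b)" "path_edges q \<subseteq> path_edges (tree_path T a b)"
    using path_first_hit[OF ab path_ends_mem(1)[OF bc]] by blast
  then have "m \<in> path_verts (tree_path T b c)" by auto
  then obtain q' r where r: "is_path T m r c"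
    "path_verts (tree_path T b c) = path_verts q' \<union> path_verts r"
    "path_edges (tree_path T b c) = path_edges q' \<union> path_edges r"
    using is_path_split[OF bc] by metis
  have "path_verts q \<inter> path_verts r = {m}" using q r path_ends_mem(1)[OF r(1)] by auto
  then obtain s where s: "is_path T a s c" "path_verts s = path_verts q \<union> path_verts r"
    "path_edges s = path_edges q \<union> path_edges r"
    using is_path_join[OF q(1) r(1)] by blast
  have "tree_path T a c = s" using tree_path_eqI[OF T s(1)] .
  then show "path_verts (tree_path T a c) \<subseteq> path_verts (tree_path T a b) \<union> path_verts (tree_path T b c)"
    "path_edges (tree_path T a c) \<subseteq> path_edges (tree_path T a b) \<union> path_edges (tree_path T b c)"
    using s q r by auto
qed

text \<open>\<open>sep\<close> and \<open>sep'\<close> are complements of equivalence relations, neither of which is total; then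
  their union is not total either.\<close>

lemma common_separated_pair:
  assumes "a \<in> R" "b \<in> R" "c \<in> R" "d \<in> R" and "sep a b" "sep' c d"
    and "\<And>x y. x \<in> R \<Longrightarrow> y \<in> R \<Longrightarrow> sep x y \<Longrightarrow> sep y x"
    and "\<And>x y. x \<in> R \<Longrightarrow> y \<in> R \<Longrightarrow> sep' x y \<Longrightarrow> sep' y x"
    and "\<And>x y z. x \<in> R \<Longrightarrow> y \<in> R \<Longrightarrow> z \<in> R \<Longrightarrow> sep x z \<Longrightarrow> sep x y \<or> sep y z"
    and "\<And>x y z. x \<in> R \<Longrightarrow> y \<in> R \<Longrightarrow> z \<in> R \<Longrightarrow> sep' x z \<Longrightarrow> sep' x y \<or> sep' y z"
  shows "\<exists>x \<in> R. \<exists>y \<in> R. sep x y \<and> sep' x y"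
proof (cases "sep' a b")
  case False
  \<comment> \<open>One of \<open>c\<close>, \<open>d\<close>, called \<open>t\<close>, lies outside
    the \<open>sep'\<close>-class of \<open>a\<close>, which contains \<open>b\<close>. So
    \<open>t\<close> is \<open>sep'\<close>-apart from both \<open>a\<close> and \<open>b\<close>,
    and \<open>sep\<close>-apart from at least one of them.\<close>
  have "sep' a c \<or> sep' a d" using assms by metis
  then obtain t where "t \<in> R" "sep' a t" using assms by blast
  moreover have "sep' b t" using calculation False assms by metis
  moreover have "sep a t \<or> sep b t" using calculation(1) assms by metis
  ultimately show ?thesis using assms(1,2) by blast
qed (use assms in blast)

section \<open>Drawn paths as arcs and Jordan curves\<close>

locale plane_graph =
  fixes G :: "('v, 'e) mgraph" and \<phi> :: "'v \<Rightarrow> complex" and \<gamma> :: "'e \<Rightarrow> real \<Rightarrow> complex"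
  assumes multigraph: "multigraph G" and drawing: "planar_drawing G \<phi> \<gamma>"
begin

text \<open>Adding the vertices makes a path without edges a point instead of the empty set.\<close>

definition drawn :: "'v list \<times> 'e list \<Rightarrow> complex set" where
  "drawn p = \<phi> ` path_verts p \<union> (\<Union>e \<in> path_edges p. path_image (\<gamma> e))"

lemma inj_vertices: "inj_on \<phi> (verts G)"
  using drawing by (simp add: planar_drawing_def)

lemma edge_vertices:
  "e \<in> edges G \<Longrightarrow> path_image (\<gamma> e) \<inter> \<phi> ` verts G = \<phi> ` ends G e"
  using drawing by (simp add: planar_drawing_def)

lemma edges_Int:
  "e \<in> edges G \<Longrightarrow> f \<in> edges G \<Longrightarrow> e \<noteq> f \<Longrightarrow>
    path_image (\<gamma> e) \<inter> path_image (\<gamma> f) = \<phi> ` (ends G e \<inter> ends G f)"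
  using drawing by (simp add: planar_drawing_def)

lemma vertex_in_drawn: "v \<in> path_verts p \<Longrightarrow> \<phi> v \<in> drawn p"
  by (simp add: drawn_def)

lemma vertex_in_drawn_iff:
  assumes "is_path G u p v" "w \<in> verts G"
  shows "\<phi> w \<in> drawn p \<longleftrightarrow> w \<in> path_verts p"
proof
  assume "\<phi> w \<in> drawn p"
  then consider "\<phi> w \<in> \<phi> ` path_verts p" | e where "e \<in> path_edges p" "\<phi> w \<in> path_image (\<gamma> e)"
    by (auto simp: drawn_def)
  then show "w \<in> path_verts p"
  proof cases
    case 1
    then show ?thesis
      using inj_vertices assms path_in_graph(1)[OF assms(1)] by (metis inj_on_image_mem_iff)
  next
    case 2
    have e: "e \<in> edges G" "ends G e \<subseteq> path_verts p"
      using path_in_graph(2)[OF assms(1)] path_edge_ends[OF assms(1)] 2 by auto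
    then have "\<phi> w \<in> \<phi> ` ends G e"
      using 2 assms(2) edge_vertices by blast
    then have "w \<in> ends G e"
      using inj_vertices assms(2) e path_in_graph(1)[OF assms(1)]
      by (meson inj_on_image_mem_iff subset_trans)
    then show ?thesis using e by auto
  qed
qed (rule vertex_in_drawn)

text \<open>Edge-disjointness leaves vertices as the only common points, since different edges meet
  only in common ends; a vertex that lies on a drawn path belongs to that path.\<close>

lemma drawn_Int:
  assumes p: "is_path G u p v" and q: "is_path G u' q v'"
    and E: "path_edges p \<inter> path_edges q = {}"
  shows "drawn p \<inter> drawn q = \<phi> ` (path_verts p \<inter> path_verts q)"
proof
  note pin = path_in_graph[OF p] path_edge_ends[OF p]
  note qin = path_in_graph[OF q] path_edge_ends[OF q]
  show "drawn p \<inter> drawn q \<subseteq> \<phi> ` (path_verts p \<inter> path_verts q)"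
  proof
    fix z assume z: "z \<in> drawn p \<inter> drawn q"
    have "\<exists>w \<in> verts G. z = \<phi> w"
    proof (rule ccontr)
      assume no: "\<not> ?thesis"
      obtain e where e: "e \<in> path_edges p" "z \<in> path_image (\<gamma> e)"
        using z no pin(1) by (auto simp: drawn_def)
      obtain f where f: "f \<in> path_edges q" "z \<in> path_image (\<gamma> f)"
        using z no qin(1) by (auto simp: drawn_def)
      have "e \<noteq> f" "e \<in> edges G" "f \<in> edges G" using e f E pin qin by auto
      then have "z \<in> \<phi> ` (ends G e \<inter> ends G f)"
        using edges_Int e f by blast
      moreover have "ends G e \<subseteq> verts G" using e pin by blast
      ultimately show False using no by auto
    qed
    then obtain w where "w \<in> verts G" "z = \<phi> w" by auto
    then show "z \<in> \<phi> ` (path_verts p \<inter> path_verts q)"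
      using z vertex_in_drawn_iff[OF p] vertex_in_drawn_iff[OF q] by auto
  qed
qed (auto simp: drawn_def)

lemma edge_arc:
  assumes "e \<in> edges G" "ends G e = {u, v}"
  obtains g where "arc g" "path_image g = path_image (\<gamma> e)" "pathstart g = \<phi> u" "pathfinish g = \<phi> v"
proof -
  have a: "arc (\<gamma> e)" "{pathstart (\<gamma> e), pathfinish (\<gamma> e)} = {\<phi> u, \<phi> v}"
    using drawing assms by (auto simp: planar_drawing_def)
  then consider "pathstart (\<gamma> e) = \<phi> u" "pathfinish (\<gamma> e) = \<phi> v"
    | "pathstart (\<gamma> e) = \<phi> v" "pathfinish (\<gamma> e) = \<phi> u"
    by (auto simp: doubleton_eq_iff)
  then show ?thesis
  proof cases
    case 1
    then show ?thesis using that a by blast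
  next
    case 2
    then show ?thesis using that[of "reversepath (\<gamma> e)"] a by (simp add: arc_reversepath)
  qed
qed

lemma drawn_arc:
  assumes "is_path G u p v" "u \<noteq> v"
  obtains g where "arc g" "path_image g = drawn p" "pathstart g = \<phi> u" "pathfinish g = \<phi> v"
proof -
  \<comment> \<open>\<open>es \<noteq> []\<close> takes the place of \<open>u \<noteq> v\<close>: a
    single point is no arc, so the last edge has to be a case of its own in the induction.\<close>
  have "\<exists>g. arc g \<and> path_image g = drawn (vs, es) \<and> pathstart g = \<phi> u \<and> pathfinish g = \<phi> v"
    if "is_path G u (vs, es) v" "es \<noteq> []" for vs es
    using that
  proof (induction es arbitrary: u vs)
    case (Cons e es)
    obtain ws where vs: "vs = u # ws" using Cons.prems(1) by (cases vs) (auto simp: is_path_def)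
    have ws: "ws \<noteq> []" "u \<notin> set ws" "length ws = Suc (length es)"
      using Cons.prems(1) vs by (auto simp: is_path_def)
    define w where "w = hd ws"
    have w: "w \<in> set ws" using ws w_def by simp
    have e: "e \<in> edges G" "ends G e = {u, w}"
      using Cons.prems(1) vs ws by (auto simp: is_path_def hd_conv_nth w_def)
    have tl: "is_path G w (ws, es) v"
      using Cons.prems(1) vs w_def by (auto intro: is_path_tl)
    have ed: "is_path G u ([u, w], [e]) w"
      using e Cons.prems(1) vs w ws by (auto simp: is_path_def)
    obtain g where g: "arc g" "path_image g = path_image (\<gamma> e)" "pathstart g = \<phi> u" "pathfinish g = \<phi> w"
      using edge_arc[OF e] by blast
    have "\<phi> u \<in> path_image g" "\<phi> w \<in> path_image g"
      using g by (metis pathstart_in_path_image pathfinish_in_path_image)+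
    then have ge: "path_image g = drawn ([u, w], [e])"
      using g(2) by (auto simp: drawn_def path_verts_def path_edges_def)
    show ?case
    proof (cases "es = []")
      case True
      then have "ws = [w]" "v = w" using ws tl by (auto simp: is_path_def length_Suc_conv)
      then show ?thesis using g ge vs True by auto
    next
      case False
      then obtain h where h: "arc h" "path_image h = drawn (ws, es)" "pathstart h = \<phi> w" "pathfinish h = \<phi> v"
        using Cons.IH[OF tl] by blast
      have "e \<notin> set es"
        using path_edge_ends[OF tl] e ws(2) by (auto simp: path_edges_def path_verts_def)
      then have "drawn ([u, w], [e]) \<inter> drawn (ws, es) = \<phi> ` ({u, w} \<inter> set ws)"
        using drawn_Int[OF ed tl] by (auto simp: path_edges_def path_verts_def)
      then have int: "path_image g \<inter> path_image h \<subseteq> {pathstart h}"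
        using ge h ws(2) by auto
      have "arc (g +++ h)"
        using arc_join[OF g(1) h(1) _ int] g h by simp
      moreover have "path_image (g +++ h) = drawn (vs, e # es)"
        using g h ge vs w by (auto simp: path_image_join drawn_def path_verts_def path_edges_def)
      ultimately show ?thesis using g h by (metis pathstart_join pathfinish_join)
    qed
  qed simp
  moreover obtain vs es where p: "p = (vs, es)" by force
  moreover have "es \<noteq> []" using assms p by (auto simp: is_path_def length_Suc_conv)
  ultimately show ?thesis using that assms(1) by blast
qed

lemma drawn_trivial:
  assumes "is_path G u p u"
  shows "drawn p = {\<phi> u}"
proof -
  obtain vs es where p: "p = (vs, es)" by force
  have "es = []" using trivial_path_edges[OF assms] p by (simp add: path_edges_def)
  then have "vs = [u]" using assms p by (auto simp: is_path_def length_Suc_conv)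
  then show ?thesis using p \<open>es = []\<close> by (simp add: drawn_def path_verts_def path_edges_def)
qed

lemma drawn_continuum:
  assumes "is_path G u p v"
  shows "compact (drawn p)" "connected (drawn p)" "closed (drawn p)"
proof -
  show "compact (drawn p)" "connected (drawn p)"
    using drawn_trivial drawn_arc assms
    by (metis compact_arc_image connected_arc_image compact_sing connected_sing)+
  then show "closed (drawn p)" by (simp add: compact_imp_closed)
qed

lemma drawn_minus_ends:
  assumes "is_path G u p v" "u \<noteq> v"
  shows "connected (drawn p - {\<phi> u})"
    and "connected (drawn p - {\<phi> u, \<phi> v})"
    and "\<phi> u \<in> closure (drawn p - {\<phi> u, \<phi> v})"
    and "\<phi> v \<in> closure (drawn p - {\<phi> u, \<phi> v})"
proof -
  obtain g where g: "arc g" "path_image g = drawn p" "pathstart g = \<phi> u" "pathfinish g = \<phi> v"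
    using drawn_arc[OF assms] by blast
  show "connected (drawn p - {\<phi> u})" "connected (drawn p - {\<phi> u, \<phi> v})"
    "\<phi> u \<in> closure (drawn p - {\<phi> u, \<phi> v})" "\<phi> v \<in> closure (drawn p - {\<phi> u, \<phi> v})"
    using arc_minus_ends[OF g(1)] g by simp_all
qed

lemma drawn_cycle:
  assumes p: "is_path G u p v" and q: "is_path G v q u" and "u \<noteq> v"
    and V: "path_verts p \<inter> path_verts q = {u, v}" and E: "path_edges p \<inter> path_edges q = {}"
  obtains c where "simple_path c" "pathfinish c = pathstart c" "path_image c = drawn p \<union> drawn q"
proof -
  obtain g where g: "arc g" "path_image g = drawn p" "pathstart g = \<phi> u" "pathfinish g = \<phi> v"
    using drawn_arc[OF p] assms by blast
  obtain h where h: "arc h" "path_image h = drawn q" "pathstart h = \<phi> v" "pathfinish h = \<phi> u"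
    using drawn_arc[OF q] assms by blast
  have "simple_path (g +++ h)"
    using drawn_Int[OF p q E] V g h by (intro simple_path_join_loop) auto
  then show ?thesis using that[of "g +++ h"] g h by (simp add: path_image_join)
qed

end

section \<open>Terminal paths in a CIST: separation and disjointness\<close>

locale plane_cist = plane_graph G \<phi> \<gamma>
  for G :: "('v, 'e) mgraph" and \<phi> :: "'v \<Rightarrow> complex" and \<gamma> :: "'e \<Rightarrow> real \<Rightarrow> complex" +
  fixes R :: "'v set" and \<T> :: "('v, 'e) mgraph set"
  assumes cist: "CIST G R \<T>"
begin

abbreviation V where "V T u v \<equiv> path_verts (tree_path T u v)"
abbreviation E where "E T u v \<equiv> path_edges (tree_path T u v)"
abbreviation D where "D T u v \<equiv> drawn (tree_path T u v)"

text \<open>For a tree of the CIST this is int(T): all its leaves are terminals, so the vertices of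
  degree at least 2 are those inside a path between two terminals. The form matches the paths that
  \<open>CIST\<close> constrains.\<close>

definition inn :: "('v, 'e) mgraph \<Rightarrow> 'v set" where
  "inn T = (\<Union>u \<in> R. \<Union>v \<in> R. V T u v - {u, v})"

lemma member:
  assumes "T \<in> \<T>"
  shows "tree T" "R \<subseteq> verts T" "multigraph T" "subgraph T G"
  using cist assms by (auto simp: CIST_def steiner_tree_def tree_def)

lemma R_verts: "T \<in> \<T> \<Longrightarrow> r \<in> R \<Longrightarrow> r \<in> verts G"
  using member(2)[of T] member(4)[of T] by (auto simp: subgraph_def)

lemma path_lift: "T \<in> \<T> \<Longrightarrow> is_path T u p v \<Longrightarrow> is_path G u p v"
  using member(4)[of T] by (auto simp: subgraph_def is_path_def split: prod.splits)

lemma tpath: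
  assumes "T \<in> \<T>" "u \<in> R" "v \<in> R"
  shows "is_path T u (tree_path T u v) v" "is_path G u (tree_path T u v) v"
  using tree_path_is_path[of T u v] member[OF assms(1)] path_lift assms by blast+

lemma V_sub: "u \<in> R \<Longrightarrow> v \<in> R \<Longrightarrow> V T u v \<subseteq> {u, v} \<union> inn T"
  by (auto simp: inn_def)

lemma path_swap:
  assumes "T \<in> \<T>" "u \<in> R" "v \<in> R"
  shows "V T v u = V T u v" "E T v u = E T u v" "D T v u = D T u v"
proof -
  show "V T v u = V T u v" "E T v u = E T u v"
    using tree_path_sym[of T u v] member[OF assms(1)] assms(2,3) by blast+
  then show "D T v u = D T u v" by (simp add: drawn_def)
qed

lemma path_via:
  assumes "T \<in> \<T>" "a \<in> R" "b \<in> R" "c \<in> R"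
  shows "V T a c \<subseteq> V T a b \<union> V T b c" "E T a c \<subseteq> E T a b \<union> E T b c"
  using tree_path_via[of T a b c] member[OF assms(1)] assms by blast+

lemma separation:
  assumes "T \<in> \<T>" "x \<in> R" "y \<in> R"
  shows "v \<in> V T x y \<Longrightarrow> v \<in> V T y x" and "e \<in> E T x y \<Longrightarrow> e \<in> E T y x"
    and "z \<in> R \<Longrightarrow> v \<in> V T x z \<Longrightarrow> v \<in> V T x y \<or> v \<in> V T y z"
    and "z \<in> R \<Longrightarrow> e \<in> E T x z \<Longrightarrow> e \<in> E T x y \<or> e \<in> E T y z"
  using path_swap(1,2)[OF assms] path_via[OF assms] by blast+

lemma independent:
  assumes "T \<in> \<T>" "T' \<in> \<T>" "T \<noteq> T'" "u \<in> R" "v \<in> R" "u \<noteq> v"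
  shows "E T u v \<inter> E T' u v = {}" "V T u v \<inter> V T' u v = {u, v}"
proof -
  have "E T u v \<inter> E T' u v = {} \<and> inner_verts (tree_path T u v) \<inter> inner_verts (tree_path T' u v) = {}"
    using cist assms unfolding CIST_def by blast
  then show "E T u v \<inter> E T' u v = {}" "V T u v \<inter> V T' u v = {u, v}"
    using inner_verts_is_path[OF tpath(1)] path_ends_mem[OF tpath(1)] assms by auto
qed

text \<open>If \<open>v\<close> is inner in both trees, it separates some pair of terminals in each,
  so \<open>common_separated_pair\<close> yields one pair that it separates in both, against
  \<open>independent\<close>. The relation lives on \<open>R - {v}\<close>, because a pair with
  \<open>v\<close> as an end would give no contradiction.\<close>

lemma inn_disjoint:
  assumes "T \<in> \<T>" "T' \<in> \<T>" "T \<noteq> T'"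
  shows "inn T \<inter> inn T' = {}"
proof (rule ccontr)
  assume "inn T \<inter> inn T' \<noteq> {}"
  then obtain v where v: "v \<in> inn T" "v \<in> inn T'" by auto
  obtain a b where ab: "a \<in> R - {v}" "b \<in> R - {v}" "v \<in> V T a b"
    using v(1) unfolding inn_def by blast
  obtain c d where cd: "c \<in> R - {v}" "d \<in> R - {v}" "v \<in> V T' c d"
    using v(2) unfolding inn_def by blast
  have "\<exists>x \<in> R - {v}. \<exists>y \<in> R - {v}. v \<in> V T x y \<and> v \<in> V T' x y"
    by (rule common_separated_pair[where sep = "\<lambda>x y. v \<in> V T x y" and sep' = "\<lambda>x y. v \<in> V T' x y",
        OF ab(1,2) cd(1,2) ab(3) cd(3)])
      (use separation(1,3) assms in blast)+
  then obtain x y where xy: "x \<in> R" "y \<in> R" "x \<noteq> v" "y \<noteq> v" "v \<in> V T x y" "v \<in> V T' x y" by auto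
  have "x \<noteq> y"
  proof
    assume "x = y"
    then have "D T x y = {\<phi> x}" using drawn_trivial tpath(2) assms xy by metis
    then have "\<phi> v = \<phi> x" using xy vertex_in_drawn by fastforce
    moreover have "v \<in> verts G" using path_in_graph(1)[OF tpath(2)] assms xy by blast
    ultimately show False using inj_vertices R_verts assms xy by (metis inj_onD)
  qed
  then show False using independent(2)[of T T' x y] assms xy by auto
qed

text \<open>\<open>CIST\<close> compares two trees along the same pair of terminals. A common edge
  of paths with different ends separates a pair in each tree, hence a common pair in both.\<close>

lemma edges_disjoint:
  assumes "T \<in> \<T>" "T' \<in> \<T>" "T \<noteq> T'" "a \<in> R" "b \<in> R" "c \<in> R" "d \<in> R"
  shows "E T a b \<inter> E T' c d = {}"
proof (rule ccontr)
  assume "E T a b \<inter> E T' c d \<noteq> {}"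
  then obtain e where e: "e \<in> E T a b" "e \<in> E T' c d" by auto
  have "\<exists>x \<in> R. \<exists>y \<in> R. e \<in> E T x y \<and> e \<in> E T' x y"
    by (rule common_separated_pair[where sep = "\<lambda>x y. e \<in> E T x y" and sep' = "\<lambda>x y. e \<in> E T' x y",
        OF assms(4-7) e])
      (use separation(2,4) assms in blast)+
  then obtain x y where xy: "x \<in> R" "y \<in> R" "e \<in> E T x y" "e \<in> E T' x y" by auto
  then have "x \<noteq> y" using trivial_path_edges tpath(1) assms by (metis empty_iff)
  then show False using independent(1)[of T T' x y] assms xy by auto
qed

text \<open>No vertex is inner in both trees, so a common vertex of the two paths is an end of one
  of them, and it is an end or an inner vertex of the other.\<close>

lemma D_Int:
  assumes "T \<in> \<T>" "T' \<in> \<T>" "T \<noteq> T'" "a \<in> R" "b \<in> R" "c \<in> R" "d \<in> R"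
  shows "D T a b \<inter> D T' c d \<subseteq> \<phi> ` ({a, b} \<inter> ({c, d} \<union> inn T') \<union> {c, d} \<inter> inn T)"
proof -
  have "D T a b \<inter> D T' c d = \<phi> ` (V T a b \<inter> V T' c d)"
    using drawn_Int tpath(2) edges_disjoint assms by metis
  also have "\<dots> \<subseteq> \<phi> ` ({a, b} \<inter> ({c, d} \<union> inn T') \<union> {c, d} \<inter> inn T)"
    using V_sub[of a b T] V_sub[of c d T'] inn_disjoint assms by blast
  finally show ?thesis .
qed

lemma vertex_in_D_iff:
  assumes "T \<in> \<T>" "a \<in> R" "b \<in> R" "r \<in> R" "r \<notin> inn T"
  shows "\<phi> r \<in> D T a b \<longleftrightarrow> r \<in> {a, b}"
  using vertex_in_drawn_iff[OF tpath(2), of T a b r] V_sub[of a b T] R_verts[of T r] assms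
    path_ends_mem[OF tpath(1), of T a b] by auto

section \<open>Branching of a tree at three terminals\<close>

text \<open>From \<open>t\<close>, run to the first vertex \<open>m\<close> on the path between
  \<open>r\<close> and \<open>s\<close>. The open arc up to \<open>m\<close> is the chord
  \<open>K\<close>; continued from \<open>m\<close> to \<open>s\<close> it gives \<open>P\<close>,
  which joins \<open>t\<close> to \<open>s\<close> and avoids \<open>r\<close>. If \<open>s\<close>
  is inner in \<open>T\<close>, then \<open>m = s\<close> is possible; otherwise \<open>m\<close> is
  the median of the three terminals and differs from all of them.\<close>

lemma chord:
  assumes T: "T \<in> \<T>" and rst: "r \<in> R" "s \<in> R" "t \<in> R" "r \<noteq> s" "r \<noteq> t" "s \<noteq> t"
    and inn: "r \<notin> inn T" "t \<notin> inn T"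
  shows "\<exists>m K P. m \<in> V T r s \<and> m \<in> V T t s \<and> m \<noteq> r \<and> m \<noteq> t \<and> (s \<notin> inn T \<longrightarrow> m \<noteq> s) \<and>
    connected K \<and> \<phi> t \<in> closure K \<and> \<phi> m \<in> closure K \<and>
    K \<subseteq> D T t s - {\<phi> t, \<phi> s} \<and> K \<inter> D T r s = {} \<and>
    compact P \<and> connected P \<and> \<phi> t \<in> P \<and> \<phi> s \<in> P \<and> \<phi> r \<notin> P \<and>
    P \<subseteq> D T t s \<union> D T r s \<and> P - D T r s \<subseteq> K \<union> {\<phi> t}"
proof -
  note rs = tpath(1)[OF T rst(1,2)] and ts = tpath(1)[OF T rst(3,2)]
  obtain q m where q: "is_path T t q m" "path_verts q \<inter> V T r s = {m}"
    "path_verts q \<subseteq> V T t s" "path_edges q \<subseteq> E T t s"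
    using path_first_hit[OF ts path_ends_mem(2)[OF rs]] by blast
  have m: "m \<in> V T r s" "m \<in> V T t s" using q by auto
  have "r \<notin> V T t s" "t \<notin> V T r s" using V_sub[of t s T] V_sub[of r s T] rst inn by auto
  then have mrt: "m \<noteq> r" "m \<noteq> t" using m by auto
  \<comment> \<open>If \<open>m = s\<close>, then the path from \<open>t\<close> to \<open>s\<close>
    continued to \<open>r\<close> is the tree path from \<open>t\<close> to \<open>r\<close>, and it
    has \<open>s\<close> inside.\<close>
  have ms: "m \<noteq> s" if "s \<notin> inn T"
  proof
    assume "m = s"
    moreover have "path_verts q \<inter> V T s r = {m}" using q(2) path_swap(1) T rst by metis
    ultimately obtain p where p: "is_path T t p r" "path_verts p = path_verts q \<union> V T s r"
      using is_path_join[OF q(1)] tpath(1)[OF T rst(2,1)] by metis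
    then have "tree_path T t r = p" using tree_path_eqI member(1) T by metis
    then have "s \<in> V T t r" using p path_ends_mem[OF tpath(1)] T rst by auto
    then show False using V_sub[of t r T] that rst by auto
  qed
  obtain p' p where p: "is_path T r p' m" "is_path T m p s" "path_verts p' \<inter> path_verts p = {m}"
    "V T r s = path_verts p' \<union> path_verts p" "E T r s = path_edges p' \<union> path_edges p"
    using is_path_split[OF rs m(1)] by metis
  have rp: "r \<notin> path_verts p" using p(3) path_ends_mem(1)[OF p(1)] mrt by auto
  note Gq = path_lift[OF T q(1)] and Gp = path_lift[OF T p(2)] and Grs = path_lift[OF T rs]
  define K where "K = drawn q - {\<phi> t, \<phi> m}"
  define P where "P = drawn q \<union> drawn p"
  have drawn_sub: "drawn q \<subseteq> D T t s" "drawn p \<subseteq> D T r s"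
    using q p by (auto simp: drawn_def)
  have "E T r s \<inter> path_edges q = {}"
    using path_edges_disjoint[OF multigraph Grs Gq, of m] q(2) by auto
  then have q_rs: "drawn q \<inter> D T r s = {\<phi> m}"
    using drawn_Int[OF Gq Grs] q(2) by auto
  have s_rs: "\<phi> s \<in> D T r s" using vertex_in_drawn path_ends_mem(2)[OF rs] by blast
  have c1: "connected K" "\<phi> t \<in> closure K" "\<phi> m \<in> closure K"
    unfolding K_def using drawn_minus_ends[OF Gq] mrt by auto
  have c2: "K \<inter> D T r s = {}" using q_rs by (auto simp: K_def)
  then have c3: "K \<subseteq> D T t s - {\<phi> t, \<phi> s}" using drawn_sub s_rs by (auto simp: K_def)
  have c4: "compact P" unfolding P_def
    using drawn_continuum[OF Gq] drawn_continuum[OF Gp] by auto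
  have c5: "connected P" unfolding P_def
    using drawn_continuum[OF Gq] drawn_continuum[OF Gp] path_ends_mem[OF Gq] path_ends_mem[OF Gp]
    by (intro connected_Un) (auto dest: vertex_in_drawn)
  have c6: "\<phi> t \<in> P" "\<phi> s \<in> P"
    unfolding P_def using path_ends_mem[OF Gq] path_ends_mem[OF Gp] by (auto dest: vertex_in_drawn)
  have "r \<notin> path_verts q" using q(2) mrt path_ends_mem(1)[OF rs] by auto
  then have c7: "\<phi> r \<notin> P"
    unfolding P_def using vertex_in_drawn_iff[OF Gq] vertex_in_drawn_iff[OF Gp] rp R_verts[OF T rst(1)] by auto
  have c8: "P \<subseteq> D T t s \<union> D T r s" using drawn_sub by (auto simp: P_def)
  have c9: "P - D T r s \<subseteq> K \<union> {\<phi> t}"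
    using drawn_sub q_rs by (auto simp: P_def K_def)
  show ?thesis using m mrt ms c1 c2 c3 c4 c5 c6 c7 c8 c9 by blast
qed

lemma vertex_eq_iff: "T \<in> \<T> \<Longrightarrow> r \<in> R \<Longrightarrow> s \<in> R \<Longrightarrow> \<phi> r = \<phi> s \<longleftrightarrow> r = s"
  using inj_vertices R_verts by (metis inj_onD)

lemma D_open_connected:
  assumes "T \<in> \<T>" "a \<in> R" "b \<in> R" "a \<noteq> b"
  shows "connected (D T a b - {\<phi> a})" "connected (D T a b - {\<phi> a, \<phi> b})"
    and "\<phi> a \<in> closure (D T a b - {\<phi> a, \<phi> b})" "\<phi> b \<in> closure (D T a b - {\<phi> a, \<phi> b})"
    and "compact (D T a b)" "connected (D T a b)" "closed (D T a b)" "\<phi> a \<in> D T a b" "\<phi> b \<in> D T a b"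
  using drawn_minus_ends[OF tpath(2)[OF assms(1-3)] assms(4)]
    drawn_continuum[OF tpath(2)[OF assms(1-3)]] path_ends_mem[OF tpath(2)[OF assms(1-3)]]
  by (auto dest: vertex_in_drawn)

text \<open>The witness is the median vertex supplied by \<open>chord\<close>. It is used to glue
  two drawn paths of one tree after their ends have been removed.\<close>

lemma common_inner_point:
  assumes T: "T \<in> \<T>" and R: "a \<in> R" "b \<in> R" "c \<in> R" "a \<noteq> b" "a \<noteq> c" "b \<noteq> c"
    and inn: "a \<notin> inn T" "b \<notin> inn T" "c \<notin> inn T"
  shows "\<exists>z. z \<in> D T a b \<and> z \<in> D T a c \<and> z \<notin> {\<phi> a, \<phi> b, \<phi> c}"
proof -
  obtain m where m: "m \<in> V T b a" "m \<in> V T c a" "m \<noteq> b" "m \<noteq> c" "a \<notin> inn T \<longrightarrow> m \<noteq> a"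
    using chord[OF T R(2,1,3) R(4)[symmetric] R(6,5) inn(2,3)] by blast
  have "m \<in> verts G" using m path_in_graph(1)[OF tpath(2)[OF T R(2,1)]] by auto
  then have "\<phi> m \<notin> {\<phi> a, \<phi> b, \<phi> c}"
    using m inn inj_onD[OF inj_vertices] R_verts[OF T] R by blast
  moreover have "\<phi> m \<in> D T a b" "\<phi> m \<in> D T a c"
    using m path_swap(1)[OF T] R vertex_in_drawn by blast+
  ultimately show ?thesis by blast
qed

section \<open>Exclusion of K_{3,3}\<close>

text \<open>The branch vertices are \<open>a\<close>, \<open>b\<close>, \<open>c\<close> and the
  medians of the three trees. The paths of \<open>X\<close> and \<open>Y\<close> between
  \<open>a\<close> and \<open>b\<close> form a Jordan curve that passes through \<open>a\<close>,
  \<open>x\<close>, \<open>b\<close>, \<open>y\<close> in this order. The path of \<open>Z\<close>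
  joins \<open>a\<close> to \<open>b\<close>, while \<open>x\<close> and \<open>y\<close> are joined
  through \<open>c\<close>.\<close>

lemma no_three_by_three:
  assumes T: "X \<in> \<T>" "Y \<in> \<T>" "Z \<in> \<T>" "X \<noteq> Y" "X \<noteq> Z" "Y \<noteq> Z"
    and R: "a \<in> R" "b \<in> R" "c \<in> R" "a \<noteq> b" "a \<noteq> c" "b \<noteq> c"
    and inn: "\<And>r T. r \<in> {a, b, c} \<Longrightarrow> T \<in> {X, Y, Z} \<Longrightarrow> r \<notin> inn T"
  shows False
proof -
  have meet: "D T u v \<inter> D T' u' v' \<subseteq> \<phi> ` ({u, v} \<inter> {u', v'})"
    if "T \<in> {X, Y, Z}" "T' \<in> {X, Y, Z}" "T \<noteq> T'" "{u, v, u', v'} \<subseteq> {a, b, c}" for T T' u v u' v'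
  proof -
    have "w \<notin> inn T" "w \<notin> inn T'" if "w \<in> {u, v, u', v'}" for w
      using inn \<open>T \<in> {X, Y, Z}\<close> \<open>T' \<in> {X, Y, Z}\<close> \<open>{u, v, u', v'} \<subseteq> {a, b, c}\<close> that
      by (meson subsetD)+
    then have "{u, v} \<inter> ({u', v'} \<union> inn T') \<union> {u', v'} \<inter> inn T = {u, v} \<inter> {u', v'}"
      by blast
    moreover have "T \<in> \<T>" "T' \<in> \<T>" "u \<in> R" "v \<in> R" "u' \<in> R" "v' \<in> R"
      using that T R by auto
    ultimately show ?thesis using D_Int[of T T' u v u' v'] that(3) by simp
  qed
  have inns: "a \<notin> inn X" "b \<notin> inn X" "c \<notin> inn X" "a \<notin> inn Y" "b \<notin> inn Y" "c \<notin> inn Y"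
    using inn by simp_all
  obtain x K where x: "x \<in> V X a b" "x \<in> V X c b" "x \<noteq> a" "x \<noteq> c" "b \<notin> inn X \<longrightarrow> x \<noteq> b"
    and K: "connected K" "\<phi> c \<in> closure K" "\<phi> x \<in> closure K"
      "K \<subseteq> D X c b - {\<phi> c, \<phi> b}" "K \<inter> D X a b = {}"
    using chord[OF T(1) R inns(1,3)] by blast
  obtain y L where y: "y \<in> V Y b a" "y \<in> V Y c a" "y \<noteq> b" "y \<noteq> c" "a \<notin> inn Y \<longrightarrow> y \<noteq> a"
    and L: "connected L" "\<phi> c \<in> closure L" "\<phi> y \<in> closure L"
      "L \<subseteq> D Y c a - {\<phi> c, \<phi> a}" "L \<inter> D Y b a = {}"
    using chord[OF T(2) R(2,1,3) R(4)[symmetric] R(6,5) inns(5,6)] by blast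
  have \<phi>: "\<phi> a \<noteq> \<phi> b" "\<phi> a \<noteq> \<phi> c" "\<phi> b \<noteq> \<phi> c" using vertex_eq_iff[OF T(1)] R by blast+
  have xG: "x \<in> verts G" "y \<in> verts G"
    using path_in_graph(1)[OF tpath(2)] T R x y by blast+
  have \<phi>xy: "\<phi> x \<noteq> \<phi> a" "\<phi> x \<noteq> \<phi> b" "\<phi> y \<noteq> \<phi> a" "\<phi> y \<noteq> \<phi> b"
    using inj_onD[OF inj_vertices] xG x y inns R_verts[OF T(1)] R by blast+
  have xD: "\<phi> x \<in> D X a b" "\<phi> y \<in> D Y b a" using x y vertex_in_drawn by auto
  have c_off: "\<phi> c \<notin> D X a b" "\<phi> c \<notin> D Y b a"  "\<phi> c \<notin> D Z a b"
    using vertex_in_D_iff T R inn by auto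
  have XY: "D X a b \<inter> D Y b a \<subseteq> {\<phi> a, \<phi> b}" and XZ: "D X a b \<inter> D Z a b \<subseteq> {\<phi> a, \<phi> b}"
    and YZ: "D Y b a \<inter> D Z a b \<subseteq> {\<phi> a, \<phi> b}" 
    using meet[of X Y a b b a] meet[of X Z a b a b] meet[of Y Z b a a b] T by auto
  note pX = tpath(2)[OF T(1) R(1,2)] and pY = tpath(2)[OF T(2) R(2,1)]
  have "V X a b \<inter> V Y b a = {a, b}"
    using independent(2)[OF T(1,2,4) R(1,2,4)] path_swap(1)[OF T(2) R(1,2)] by simp
  then obtain J where J: "simple_path J" "pathfinish J = pathstart J" "path_image J = D X a b \<union> D Y b a"
    using drawn_cycle[OF pX pY] edges_disjoint[OF T(1,2,4)] R by metis
  \<comment> \<open>\<open>Q\<close> runs from near \<open>x\<close> along \<open>K\<close> to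
    \<open>c\<close> and on along \<open>L\<close> to near \<open>y\<close>. \<open>N\<close> is the
    inside of the path of \<open>Z\<close> with the branch of \<open>Z\<close> to \<open>c\<close>;
    it meets \<open>Q\<close> in \<open>c\<close>, which puts both crosscuts on the same
    side.\<close>
  define Q where "Q = insert (\<phi> c) (K \<union> L)"
  define N where "N = (D Z a b - {\<phi> a, \<phi> b}) \<union> (D Z c a - {\<phi> a})"
  have Q: "connected Q"
  proof -
    have "connected (insert (\<phi> c) K)" "connected (insert (\<phi> c) L)"
      using K L connected_intermediate_closure closure_subset by (metis insert_subset subset_insertI)+
    then have "connected (insert (\<phi> c) K \<union> insert (\<phi> c) L)" by (intro connected_Un) auto
    moreover have "insert (\<phi> c) K \<union> insert (\<phi> c) L = Q" by (auto simp: Q_def)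
    ultimately show ?thesis by simp
  qed
  have N: "connected N" "\<phi> c \<in> N"
  proof -
    obtain z where "z \<in> D Z a b" "z \<in> D Z a c" "z \<notin> {\<phi> a, \<phi> b, \<phi> c}"
      using common_inner_point[OF T(3) R] inn by auto
    then have "z \<in> (D Z a b - {\<phi> a, \<phi> b}) \<inter> (D Z c a - {\<phi> a})"
      using path_swap(3)[OF T(3)] R by auto
    moreover have "connected (D Z c a - {\<phi> a})"
      using D_open_connected(1)[OF T(3) R(1,3,5)] path_swap(3)[OF T(3)] R by simp
    ultimately show "connected N"
      unfolding N_def using D_open_connected(2)[OF T(3) R(1,2,4)]
      by (intro connected_Un) auto
    show "\<phi> c \<in> N" using D_open_connected(8)[of Z c a] T R \<phi> by (auto simp: N_def)
  qed
  show False
  proof (rule interlaced_crosscuts[OF J(1,2), of "D X a b" "D Y b a" "D Z a b" Q "\<phi> x" "\<phi> y" "N \<union> Q"])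
    show "closed (D X a b)" "closed (D Y b a)" "compact (D Z a b)" "connected (D Z a b)"
      using D_open_connected T R by auto
    show "D X a b \<inter> D Y b a \<subseteq> D Z a b"
      using XY D_open_connected(8,9)[OF T(3) R(1,2,4)] by auto
    show "\<phi> x \<in> D X a b - D Y b a - D Z a b" "\<phi> y \<in> D Y b a - D X a b - D Z a b"
      using xD XY XZ YZ \<phi>xy by auto
    show "\<phi> x \<in> closure Q" "\<phi> y \<in> closure Q"
      using K L closure_mono[of K Q] closure_mono[of L Q] by (auto simp: Q_def)
    have "K \<inter> D Z a b = {}" "L \<inter> D Z a b = {}" "K \<inter> D Y b a = {}" "L \<inter> D X a b = {}"
      using meet[of X Z c b a b] meet[of Y Z c a a b] meet[of X Y c b b a] meet[of Y X c a a b]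
        K(4) L(4) T R by auto
    then show "Q \<inter> D Z a b = {}" and QJ: "(N \<union> Q) \<inter> path_image J = {}"
      using K(5) L(5) c_off XZ YZ meet[of Z X c a a b] meet[of Z Y c a b a] T R
      unfolding J Q_def N_def by auto
    show "connected (N \<union> Q)" using N Q by (intro connected_Un) (auto simp: Q_def)
    show "D Z a b - path_image J \<subseteq> N \<union> Q"
      using D_open_connected(8,9)[OF T(1) R(1,2,4)] J by (auto simp: N_def)
  qed (use J Q in auto)
qed

section \<open>Exclusion of K_5\<close>

text \<open>Among the four terminals, only the i-th can be inner in the i-th of the first four
  trees. So a path of that tree which ends in its own terminal has none of the four inside, and
  every connection is drawn in the tree of one of its ends.\<close>

lemma no_complete_five:
  assumes T: "T1 \<in> \<T>" "T2 \<in> \<T>" "T3 \<in> \<T>" "T4 \<in> \<T>" "T5 \<in> \<T>"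
    and dT: "distinct [T1, T2, T3, T4, T5]"
    and R: "r1 \<in> R" "r2 \<in> R" "r3 \<in> R" "r4 \<in> R" and dR: "distinct [r1, r2, r3, r4]"
    and inn: "r1 \<notin> inn T2 \<union> inn T3 \<union> inn T4 \<union> inn T5" "r2 \<notin> inn T1 \<union> inn T3 \<union> inn T4 \<union> inn T5"
      "r3 \<notin> inn T1 \<union> inn T2 \<union> inn T4 \<union> inn T5" "r4 \<notin> inn T1 \<union> inn T2 \<union> inn T3 \<union> inn T5"
  shows False
proof -
  let ?p1 = "\<phi> r1" and ?p2 = "\<phi> r2" and ?p3 = "\<phi> r3" and ?p4 = "\<phi> r4"
  have p: "?p1 \<noteq> ?p2" "?p1 \<noteq> ?p3" "?p1 \<noteq> ?p4" "?p2 \<noteq> ?p3" "?p2 \<noteq> ?p4" "?p3 \<noteq> ?p4"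
    using vertex_eq_iff[OF T(1)] R dR by auto
  note facts = T R dT dR inn
  have d: "r1 \<noteq> r2" "r1 \<noteq> r3" "r1 \<noteq> r4" "r2 \<noteq> r3" "r2 \<noteq> r4" "r3 \<noteq> r4" using dR by auto
  \<comment> \<open>The sides of the four-cycle use each of \<open>T1\<close> to \<open>T4\<close>
    once. The diagonals reuse \<open>T3\<close> and \<open>T4\<close>, so \<open>C13\<close> may
    overlap \<open>D23\<close>, and \<open>C24\<close> may overlap \<open>D34\<close>.\<close>
  define D12 D23 D34 D41 where "D12 = D T2 r1 r2" and "D23 = D T3 r2 r3"
    and "D34 = D T4 r3 r4" and "D41 = D T1 r4 r1"
  define C13 C24 where "C13 = D T3 r1 r3" and "C24 = D T4 r2 r4"
  define F12 F13 F24 where "F12 = D T5 r1 r2" and "F13 = D T5 r1 r3" and "F24 = D T5 r2 r4"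
  note defs = D12_def D23_def D34_def D41_def C13_def C24_def F12_def F13_def F24_def
  have DD: "D12 \<inter> D23 \<subseteq> {?p2}" "D12 \<inter> D34 = {}" "D12 \<inter> D41 \<subseteq> {?p1}"
    "D23 \<inter> D34 \<subseteq> {?p3}" "D23 \<inter> D41 = {}" "D34 \<inter> D41 \<subseteq> {?p4}"
    unfolding defs
    using D_Int[of T2 T3 r1 r2 r2 r3] D_Int[of T2 T4 r1 r2 r3 r4] D_Int[of T2 T1 r1 r2 r4 r1]
      D_Int[of T3 T4 r2 r3 r3 r4] D_Int[of T3 T1 r2 r3 r4 r1] D_Int[of T4 T1 r3 r4 r4 r1] facts
    by auto
  have C13: "C13 \<inter> D12 \<subseteq> {?p1}" "C13 \<inter> D34 \<subseteq> {?p3}" "C13 \<inter> D41 \<subseteq> {?p1}"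
    "C13 \<inter> C24 = {}" "C13 \<inter> F24 = {}"
    unfolding defs
    using D_Int[of T3 T2 r1 r3 r1 r2] D_Int[of T3 T4 r1 r3 r3 r4] D_Int[of T3 T1 r1 r3 r4 r1]
      D_Int[of T3 T4 r1 r3 r2 r4] D_Int[of T3 T5 r1 r3 r2 r4] facts
    by auto
  have C24: "C24 \<inter> D12 \<subseteq> {?p2}" "C24 \<inter> D23 \<subseteq> {?p2}" "C24 \<inter> D41 \<subseteq> {?p4}" "C24 \<inter> F13 = {}"
    unfolding defs
    using D_Int[of T4 T2 r2 r4 r1 r2] D_Int[of T4 T3 r2 r4 r2 r3] D_Int[of T4 T1 r2 r4 r4 r1]
      D_Int[of T4 T5 r2 r4 r1 r3] facts
    by auto
  have F: "D12 \<inter> D T5 u v \<subseteq> {\<phi> u, \<phi> v} \<and> D23 \<inter> D T5 u v \<subseteq> {\<phi> u, \<phi> v} \<and>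
      D34 \<inter> D T5 u v \<subseteq> {\<phi> u, \<phi> v} \<and> D41 \<inter> D T5 u v \<subseteq> {\<phi> u, \<phi> v}"
    if "u \<in> {r1, r2, r3, r4}" "v \<in> {r1, r2, r3, r4}" for u v
  proof -
    have uv: "u \<in> R" "v \<in> R" "u \<notin> inn T5" "v \<notin> inn T5" using that R inn by auto
    show ?thesis
      unfolding defs
      using D_Int[of T5 T2 u v r1 r2] D_Int[of T5 T3 u v r2 r3] D_Int[of T5 T4 u v r3 r4]
        D_Int[of T5 T1 u v r4 r1] facts uv
      by (simp add: Int_commute) blast
  qed
  have ends: "?p1 \<in> D12" "?p2 \<in> D12" "?p2 \<in> D23" "?p3 \<in> D23" "?p3 \<in> D34" "?p4 \<in> D34" "?p4 \<in> D41" "?p1 \<in> D41"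
    unfolding defs using D_open_connected(8,9) T R d by blast+
  have cl: "closed D12" "closed D23" "closed D34" "closed D41"
    unfolding defs using D_open_connected(7) T R d by metis+
  obtain J where J: "simple_path J" "pathfinish J = pathstart J"
    "path_image J = D12 \<union> D23 \<union> D34 \<union> D41"
  proof -
    have V: "V T2 r1 r2 \<inter> V T3 r2 r3 = {r2}" "V T4 r3 r4 \<inter> V T1 r4 r1 = {r4}"
      "(V T2 r1 r2 \<union> V T3 r2 r3) \<inter> (V T4 r3 r4 \<union> V T1 r4 r1) = {r1, r3}"
    proof -
      have e: "{u, v} \<subseteq> V T u v" "V T u v \<subseteq> {u, v} \<union> inn T" if "T \<in> \<T>" "u \<in> R" "v \<in> R" for T u v
        using V_sub[of u v T] path_ends_mem[OF tpath(1)] that by auto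
      note e = e[OF T(2) R(1,2)] e[OF T(3) R(2,3)] e[OF T(4) R(3,4)] e[OF T(1) R(4,1)]
      have I: "inn T2 \<inter> inn T3 = {}" "inn T2 \<inter> inn T4 = {}" "inn T2 \<inter> inn T1 = {}"
        "inn T3 \<inter> inn T4 = {}" "inn T3 \<inter> inn T1 = {}" "inn T4 \<inter> inn T1 = {}"
        using inn_disjoint T dT by auto
      show "V T2 r1 r2 \<inter> V T3 r2 r3 = {r2}"
        using e(1-4) I(1) d inn by blast
      show "V T4 r3 r4 \<inter> V T1 r4 r1 = {r4}"
        using e(5-8) I(6) d inn by blast
      have "V T2 r1 r2 \<inter> V T4 r3 r4 = {}" using e(2,6) I(2) d inn by blast
      moreover have "V T2 r1 r2 \<inter> V T1 r4 r1 = {r1}" using e(1,2,7,8) I(3) d inn by blast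
      moreover have "V T3 r2 r3 \<inter> V T4 r3 r4 = {r3}" using e(3-6) I(4) d inn by blast
      moreover have "V T3 r2 r3 \<inter> V T1 r4 r1 = {}" using e(4,8) I(5) d inn by blast
      ultimately show "(V T2 r1 r2 \<union> V T3 r2 r3) \<inter> (V T4 r3 r4 \<union> V T1 r4 r1) = {r1, r3}"
        by blast
    qed
    obtain p where p: "is_path G r1 p r3" "path_verts p = V T2 r1 r2 \<union> V T3 r2 r3"
      "path_edges p = E T2 r1 r2 \<union> E T3 r2 r3"
      using is_path_join[OF tpath(2)[OF T(2) R(1,2)] tpath(2)[OF T(3) R(2,3)] V(1)] by blast
    obtain q where q: "is_path G r3 q r1" "path_verts q = V T4 r3 r4 \<union> V T1 r4 r1"
      "path_edges q = E T4 r3 r4 \<union> E T1 r4 r1"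
      using is_path_join[OF tpath(2)[OF T(4) R(3,4)] tpath(2)[OF T(1) R(4,1)] V(2)] by blast
    have "path_edges p \<inter> path_edges q = {}"
      using edges_disjoint[of T2 T4 r1 r2 r3 r4] edges_disjoint[of T2 T1 r1 r2 r4 r1]
        edges_disjoint[of T3 T4 r2 r3 r3 r4] edges_disjoint[of T3 T1 r2 r3 r4 r1] T R dT
      unfolding p q by auto
    moreover have "path_verts p \<inter> path_verts q = {r1, r3}" using V p q by simp
    ultimately obtain c where "simple_path c" "pathfinish c = pathstart c"
      "path_image c = drawn p \<union> drawn q"
      using drawn_cycle[OF p(1) q(1) d(2)] by blast
    moreover have "drawn p \<union> drawn q = D12 \<union> D23 \<union> D34 \<union> D41"
      unfolding drawn_def defs p q by auto
    ultimately show ?thesis using that by simp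
  qed
  \<comment> \<open>\<open>K\<close> is the part of the diagonal \<open>C13\<close> before it meets
    \<open>D23\<close>. \<open>P\<close> joins the corners \<open>r1\<close> and \<open>r3\<close>
    and may use a part of \<open>D23\<close>, but not \<open>r2\<close>.\<close>
  obtain K P where K: "connected K" "K \<subseteq> C13 - {?p1, ?p3}" "K \<inter> D23 = {}"
    and P: "compact P" "connected P" "?p1 \<in> P" "?p3 \<in> P" "?p2 \<notin> P" "P \<subseteq> C13 \<union> D23" "P - D23 \<subseteq> K \<union> {?p1}"
    using chord[of T3 r2 r3 r1] T R d inn unfolding defs by auto
  obtain n L Q where n: "n \<in> V T4 r3 r4" "n \<noteq> r3"
    and L: "connected L" "?p2 \<in> closure L" "\<phi> n \<in> closure L" "L \<subseteq> C24 - {?p2, ?p4}" "L \<inter> D34 = {}"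
    and Q: "compact Q" "connected Q" "?p2 \<in> Q" "?p4 \<in> Q" "?p3 \<notin> Q" "Q \<subseteq> C24 \<union> D34" "Q - D34 \<subseteq> L \<union> {?p2}"
    using chord[of T4 r3 r4 r2] T R d inn unfolding defs by auto
  have "n \<in> verts G" using path_in_graph(1)[OF tpath(2)[OF T(4) R(3,4)]] n by auto
  then have n': "\<phi> n \<in> D34" "\<phi> n \<noteq> ?p3"
    using n vertex_in_drawn inj_onD[OF inj_vertices] R_verts[OF T(1) R(3)] unfolding defs by blast+
  \<comment> \<open>This is the branch set of the fifth tree: three of its paths without their ends,
    glued at medians. It misses the curve, as none of the four terminals is inner in
    \<open>T5\<close>.\<close>
  define S where "S = (F24 - {?p2, ?p4}) \<union> (F12 - {?p1, ?p2}) \<union> (F13 - {?p1, ?p3})"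
  have S: "connected S"
  proof -
    obtain z where z: "z \<in> D T5 r2 r4" "z \<in> D T5 r2 r1" "z \<notin> {?p2, ?p4, ?p1}"
      using common_inner_point[OF T(5) R(2,4,1)] d inn by auto
    obtain w where w: "w \<in> D T5 r1 r2" "w \<in> D T5 r1 r3" "w \<notin> {?p1, ?p2, ?p3}"
      using common_inner_point[OF T(5) R(1,2,3)] d inn by auto
    have "connected (F24 - {?p2, ?p4})" "connected (F12 - {?p1, ?p2})" "connected (F13 - {?p1, ?p3})"
      unfolding defs using D_open_connected(2) T R d by metis+
    moreover have "z \<in> (F24 - {?p2, ?p4}) \<inter> (F12 - {?p1, ?p2})"
      using z path_swap(3)[OF T(5) R(1,2)] unfolding defs by auto
    moreover have "w \<in> (F24 - {?p2, ?p4} \<union> (F12 - {?p1, ?p2})) \<inter> (F13 - {?p1, ?p3})"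
      using w unfolding defs by auto
    ultimately show ?thesis unfolding S_def by (metis connected_Un empty_iff)
  qed
  have F24: "F24 \<inter> P \<subseteq> {?p2, ?p4}"
    using F[of r2 r4] C13 P(6) by (auto simp: F24_def)
  have F13: "F13 \<inter> Q \<subseteq> {?p1, ?p3}"
    using F[of r1 r3] C24 Q(6) by (auto simp: F13_def)
  have off: "K \<inter> path_image J = {}" "L \<inter> path_image J = {}" "S \<inter> path_image J = {}"
  proof -
    show "K \<inter> path_image J = {}" using K(2,3) C13 unfolding J by blast
    show "L \<inter> path_image J = {}" using L(4,5) C24 unfolding J by blast
    have "D T5 u v \<inter> path_image J \<subseteq> {\<phi> u, \<phi> v}"
      if "u \<in> {r1, r2, r3, r4}" "v \<in> {r1, r2, r3, r4}" for u v
      using F[OF that] unfolding J by blast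
    from this[of r2 r4] this[of r1 r2] this[of r1 r3] show "S \<inter> path_image J = {}"
      unfolding S_def F24_def F12_def F13_def by auto
  qed
  have PJ: "P - path_image J \<subseteq> K" using P(7) ends unfolding J by blast
  have QJ: "Q - path_image J \<subseteq> L" using Q(7) ends unfolding J by blast
  have A: "(D12 \<union> D23) \<union> (D34 \<union> D41) = path_image J" "(D23 \<union> D34) \<union> (D41 \<union> D12) = path_image J"
    "(D12 \<union> D23) \<inter> (D34 \<union> D41) \<subseteq> P" "(D23 \<union> D34) \<inter> (D41 \<union> D12) \<subseteq> Q"
    using J DD P(3,4) Q(3,4) by blast+
  have cl2: "closed (D12 \<union> D23)" "closed (D34 \<union> D41)" "closed (D23 \<union> D34)" "closed (D41 \<union> D12)"
    using cl by auto
  obtain M where M: "connected M" "M \<inter> path_image J = {}"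
    "K \<subseteq> M \<and> L \<subseteq> M \<or> K \<subseteq> M \<and> S \<subseteq> M \<or> L \<subseteq> M \<and> S \<subseteq> M"
    using two_of_three_on_one_side[OF J(1,2) K(1) L(1) S off] by blast
  have x2: "?p2 \<in> (D12 \<union> D23) - (D34 \<union> D41) - P"
    using ends DD P(5) p by blast
  from M(3) show False
  proof (elim disjE conjE)
    \<comment> \<open>\<open>P\<close> joins \<open>r1\<close> to \<open>r3\<close>;
      \<open>L\<close> leads from \<open>r2\<close> to \<open>n\<close>, where the diagonal
      \<open>C24\<close> first meets \<open>D34\<close>. Since \<open>n\<close> differs from
      \<open>r3\<close>, its point is off \<open>P\<close> and strictly on the opposite part of the
      curve.\<close>
    assume KL: "K \<subseteq> M" "L \<subseteq> M"
    have "\<phi> n \<in> (D34 \<union> D41) - (D12 \<union> D23) - P"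
      using n' DD C13 P(6) by blast
    moreover have "L \<inter> P = {}" using L(4) P(6) C13 C24 by blast
    moreover have "P - path_image J \<subseteq> M" using PJ KL by blast
    ultimately show False
      using interlaced_crosscuts[OF J(1,2) cl2(1,2) A(1,3) P(1,2) L(1) _ x2 L(2) _ L(3) M(1,2) KL(2)] by blast
  next
    \<comment> \<open>Here the crossing partner of \<open>P\<close> is the path of \<open>T5\<close>
      from \<open>r2\<close> to \<open>r4\<close>.\<close>
    assume KS: "K \<subseteq> M" "S \<subseteq> M"
    let ?F = "F24 - {?p2, ?p4}"
    have F: "connected ?F" "?p2 \<in> closure ?F" "?p4 \<in> closure ?F"
      unfolding F24_def using D_open_connected(2-4)[OF T(5) R(2,4) d(5)] .
    have "?p4 \<notin> D12" "?p4 \<notin> D23" "?p4 \<notin> C13"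
      using ends(6) DD(2,4) C13(2) p(6) by auto
    then have "?p4 \<in> (D34 \<union> D41) - (D12 \<union> D23) - P"
      using ends(6) P(6) by auto
    moreover have "?F \<inter> P = {}" using F24 by blast
    moreover have "P - path_image J \<subseteq> M" "?F \<subseteq> M" using PJ KS by (auto simp: S_def)
    ultimately show False
      using interlaced_crosscuts[OF J(1,2) cl2(1,2) A(1,3) P(1,2) F(1) _ x2 F(2) _ F(3) M(1,2)] by blast
  next
    \<comment> \<open>The roles move on by one corner: the curve is cut at \<open>r2\<close> and
      \<open>r4\<close>, which \<open>Q\<close> joins, and the path of \<open>T5\<close> from
      \<open>r1\<close> to \<open>r3\<close> crosses.\<close>
    assume LS: "L \<subseteq> M" "S \<subseteq> M"
    let ?F = "F13 - {?p1, ?p3}"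
    have F: "connected ?F" "?p1 \<in> closure ?F" "?p3 \<in> closure ?F"
      unfolding F13_def using D_open_connected(2-4)[OF T(5) R(1,3) d(2)] .
    have "?p3 \<notin> D41" "?p3 \<notin> D12"
      using ends(4,5) DD(2,5) by auto
    then have "?p3 \<in> (D23 \<union> D34) - (D41 \<union> D12) - Q"
      using ends(5) Q(5) by auto
    moreover have "?p1 \<notin> D23" "?p1 \<notin> D34" "?p1 \<notin> C24"
      using ends(1) DD(1,2) C24(1) p(1) by auto
    then have "?p1 \<in> (D41 \<union> D12) - (D23 \<union> D34) - Q"
      using ends(1) Q(6) by auto
    moreover have "?F \<inter> Q = {}" using F13 by blast
    moreover have "Q - path_image J \<subseteq> M" "?F \<subseteq> M" using QJ LS by (auto simp: S_def)
    ultimately show False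
      using interlaced_crosscuts[OF J(1,2) cl2(3,4) A(2,4) Q(1,2) F(1) _ _ F(3) _ F(2) M(1,2)] by blast
  qed
qed

section \<open>Counting trees\<close>

definition inner_trees :: "'v \<Rightarrow> ('v, 'e) mgraph set" where
  "inner_trees r = {T \<in> \<T>. r \<in> inn T}"

lemma finite_trees: "finite \<T>"
  using cist by (simp add: CIST_def)

lemma card_inner_trees: "finite (inner_trees r)" "card (inner_trees r) \<le> 1"
proof -
  show "finite (inner_trees r)" using finite_trees by (simp add: inner_trees_def)
  moreover have "T = T'" if "T \<in> inner_trees r" "T' \<in> inner_trees r" for T T'
    using that inn_disjoint[of T T'] by (auto simp: inner_trees_def)
  ultimately show "card (inner_trees r) \<le> 1"
    by (simp add: card_le_Suc0_iff_eq)
qed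

text \<open>By \<open>no_three_by_three\<close>, at most two trees have none of \<open>a\<close>,
  \<open>b\<close>, \<open>c\<close> as an inner vertex.\<close>

lemma card_trees_less:
  assumes "a \<in> R" "b \<in> R" "c \<in> R" "a \<noteq> b" "a \<noteq> c" "b \<noteq> c"
  shows "card \<T> < 3 + card (inner_trees a \<union> inner_trees b \<union> inner_trees c)"
proof (rule ccontr)
  let ?B = "inner_trees a \<union> inner_trees b \<union> inner_trees c"
  assume "\<not> ?thesis"
  moreover have "?B \<subseteq> \<T>" by (auto simp: inner_trees_def)
  ultimately have "3 \<le> card (\<T> - ?B)"
    using finite_trees card_inner_trees(1) by (simp add: card_Diff_subset)
  then obtain U where "U \<subseteq> \<T> - ?B" "card U = 3" by (meson obtain_subset_with_card_n)
  then obtain X Y Z where U: "{X, Y, Z} \<subseteq> \<T> - ?B" "X \<noteq> Y" "Y \<noteq> Z" "X \<noteq> Z"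
    using card_3_iff[of U] by metis
  show False
    by (rule no_three_by_three[of X Y Z a b c]) (use U assms in \<open>auto simp: inner_trees_def\<close>)
qed

lemma card_three_terminals:
  assumes "card R = 3"
  shows "card \<T> \<le> 5"
proof -
  obtain a b c where R: "R = {a, b, c}" "a \<noteq> b" "b \<noteq> c" "a \<noteq> c"
    using assms card_3_iff[of R] by metis
  have "card (inner_trees a \<union> inner_trees b \<union> inner_trees c)
      \<le> card (inner_trees a) + card (inner_trees b) + card (inner_trees c)"
    by (meson add_le_mono1 card_Un_le order_trans)
  then show ?thesis
    using card_trees_less[of a b c] card_inner_trees(2)[of a] card_inner_trees(2)[of b]
      card_inner_trees(2)[of c] R by simp
qed

lemma card_four_terminals:
  assumes "card R \<ge> 4"
  shows "card \<T> \<le> 4"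
proof (rule ccontr)
  assume "\<not> ?thesis"
  then have big: "5 \<le> card \<T>" by simp
  obtain W where W: "W \<subseteq> R" "card W = 4" using assms by (meson obtain_subset_with_card_n)
  then obtain a b c d where "W = {a, b, c, d}" "distinct [a, b, c, d]"
    by (auto simp: card_Suc_eq numeral_eq_Suc)
  then have R: "a \<in> R" "b \<in> R" "c \<in> R" "d \<in> R" and dR: "distinct [a, b, c, d]"
    using W by auto
  \<comment> \<open>With five trees \<open>card_trees_less\<close> demands a union of at least three
    trees from three sets of at most one tree each, so the sets are nonempty and pairwise
    disjoint.\<close>
  have three: "inner_trees x \<noteq> {} \<and> inner_trees x \<inter> inner_trees y = {}"
    if "x \<in> R" "y \<in> R" "z \<in> R" "x \<noteq> y" "x \<noteq> z" "y \<noteq> z" for x y z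
  proof -
    have "3 \<le> card (inner_trees x \<union> inner_trees y \<union> inner_trees z)"
      using card_trees_less[of x y z] that big by simp
    also have "\<dots> \<le> card (inner_trees x \<union> inner_trees y) + card (inner_trees z)"
      by (rule card_Un_le)
    finally have "2 \<le> card (inner_trees x \<union> inner_trees y)"
      using card_inner_trees(2)[of z] by simp
    moreover have "card (inner_trees x \<union> inner_trees y) + card (inner_trees x \<inter> inner_trees y)
        = card (inner_trees x) + card (inner_trees y)"
      using card_Un_Int card_inner_trees(1) by metis
    ultimately have "card (inner_trees x \<inter> inner_trees y) = 0" "card (inner_trees x) \<noteq> 0"
      using card_inner_trees(2)[of x] card_inner_trees(2)[of y] by linarith+
    then show ?thesis using card_inner_trees(1) by auto
  qed
  have pair: "inner_trees x \<noteq> {} \<and> inner_trees x \<inter> inner_trees y = {}"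
    if "x \<in> {a, b, c, d}" "y \<in> {a, b, c, d}" "x \<noteq> y" for x y
  proof -
    obtain z where "z \<in> {a, b, c, d}" "z \<noteq> x" "z \<noteq> y" using that dR by auto
    then show ?thesis using three[of x y z] that R by auto
  qed
  obtain A B C D' where N: "A \<in> inner_trees a" "B \<in> inner_trees b" "C \<in> inner_trees c" "D' \<in> inner_trees d"
    using pair[of a b] pair[of b a] pair[of c a] pair[of d a] dR by auto
  have dis: "inner_trees a \<inter> inner_trees b = {}" "inner_trees a \<inter> inner_trees c = {}"
    "inner_trees a \<inter> inner_trees d = {}" "inner_trees b \<inter> inner_trees c = {}"
    "inner_trees b \<inter> inner_trees d = {}" "inner_trees c \<inter> inner_trees d = {}"
    using pair dR by auto
  have T4: "A \<in> \<T>" "B \<in> \<T>" "C \<in> \<T>" "D' \<in> \<T>" using N by (simp_all add: inner_trees_def)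
  have ne: "A \<noteq> B" "A \<noteq> C" "A \<noteq> D'" "B \<noteq> C" "B \<noteq> D'" "C \<noteq> D'" using N dis by blast+
  then have d4: "distinct [A, B, C, D']" by simp
  then have "card {A, B, C, D'} = 4" by simp
  then have "\<not> \<T> \<subseteq> {A, B, C, D'}"
    using big card_mono[of "{A, B, C, D'}" \<T>] by auto
  then obtain F where F: "F \<in> \<T>" "F \<notin> {A, B, C, D'}" by auto
  \<comment> \<open>Each of the four terminals is inner in its own tree, hence in no other, and in
    particular not in the fifth tree \<open>F\<close>.\<close>
  have only: "r \<notin> inn T" if "X \<in> inner_trees r" "T \<in> \<T>" "T \<noteq> X" for r X T
    using that inn_disjoint[of X T] by (auto simp: inner_trees_def)
  show False
  proof (rule no_complete_five[of A B C D' F a b c d])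
    show "distinct [A, B, C, D', F]" using d4 F by auto
    show "a \<notin> inn B \<union> inn C \<union> inn D' \<union> inn F" using only[OF N(1)] T4 ne ne[symmetric] F by simp
    show "b \<notin> inn A \<union> inn C \<union> inn D' \<union> inn F" using only[OF N(2)] T4 ne ne[symmetric] F by simp
    show "c \<notin> inn A \<union> inn B \<union> inn D' \<union> inn F" using only[OF N(3)] T4 ne ne[symmetric] F by simp
    show "d \<notin> inn A \<union> inn B \<union> inn C \<union> inn F" using only[OF N(4)] T4 ne ne[symmetric] F by simp
  qed (use T4 F R dR in simp_all)
qed

end

theorem theorem3p19:
  fixes G :: "('v, 'e) mgraph" and R :: "'v set"
  assumes "multigraph G" and "connected_graph G" and "planar G" and "R \<subseteq> verts G"
  shows "(card R = 3 \<longrightarrow> (\<forall>\<T>. CIST G R \<T> \<longrightarrow> card \<T> \<le> 5)) \<and>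
         (card R \<ge> 4 \<longrightarrow> (\<forall>\<T>. CIST G R \<T> \<longrightarrow> card \<T> \<le> 4))"
proof -
  obtain \<phi> \<gamma> where "planar_drawing G \<phi> \<gamma>" using assms(3) by (auto simp: planar_def)
  then have "plane_cist G \<phi> \<gamma> R \<T>" if "CIST G R \<T>" for \<T>
    using that assms(1) by (simp add: plane_cist_def plane_graph_def plane_cist_axioms_def)
  then show ?thesis
    using plane_cist.card_three_terminals plane_cist.card_four_terminals by blast
qed

end
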